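(* Let $(\mu_t)_{t\in I}$ be an $n$-dimensional spacelike Brakke flow with boundary $\Gamma$ in an open set $U\subset\mathbf R^{n,m}$ and let $\phi\in C^2_c(U;\mathbf R^+)$. If $$K(v^2,I):=\sup_{t\in I}\int_{\operatorname{spt}\phi}v^2(\mu_t,\cdot)\,d\mu_t<\infty,$$ then $$t\in I\mapsto\mu_t(\phi)+m\,\big(\max|\nabla^2\phi|_{\mathbf R^{n+m}}\big)\,K(v^2,I)\,t$$ is a non-decreasing function of $t$.
   Context: **Ambient space.** $\mathbf R^{n,m}$ is $\mathbf R^{n+m}$ with $\langle u,w\rangle=\sum_{i=1}^n u^iw^i-\sum_{i=n+1}^{n+m}u^iw^i$ and canonical basis $e_1,\dots,e_{n+m}$; $\langle\cdot,\cdot\rangle_E$ and $|\cdot|_E$ are the Euclidean product and norm; $|\nabla^2\phi|_{\mathbf R^{n+m}}$ is the Euclidean norm of the Hessian as a tensor on $\mathbf R^{n+m}$. A vector $u$ is spacelike if $\langle u,u\rangle>0$ or $u=0$; a subspace is spacelike if $\langle\cdot,\cdot\rangle$ is positive definite on it; a submanifold is spacelike if its tangent spaces are. Orthogonality, $\perp$, orthogonal projections and gradients $\nabla$ are with respect to $\langle\cdot,\cdot\rangle$. $K\Subset U$ means $K$ has compact closure in $U$; $\mathbf R^+=[0,\infty)$. **Rectifiable sets and area.** An $\mathcal H^n$-measurable set $M$ is $n$-rectifiable if $\mathcal H^n$-almost all of it is covered by countably many $n$-dimensional $C^1$ submanifolds; $\operatorname{Tan}(M,x)$ is its (approximate) tangent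 plane, which exists $\mathcal H^n$-a.e. $M$ is spacelike if $\operatorname{Tan}(M,x)$ is spacelike wherever it exists. For a spacelike plane $P$, $S(P)=\sqrt{\det(\langle\cdot,\cdot\rangle|_P)}/\sqrt{\det(\langle\cdot,\cdot\rangle_E|_P)}$, and $d\sigma^n=S(\operatorname{Tan}(M,\cdot))\,d\mathcal H^n$ on $M$; $\sigma^{n-1}$ is defined likewise. **Gradient function.** For a spacelike $n$-plane $P$, $v^2(P)=\sum_{i=n+1}^{n+m}-\langle e_i^\perp,e_i^\perp\rangle\ge m$, $e_i^\perp$ the projection of $e_i$ onto $P^\perp$. **Spacelike integer measures.** A Radon measure $\mu$ on $U$ is spacelike integer $n$-rectifiable if $\mu=\theta\,\sigma^n\llcorner M$ with $M\subset U$ spacelike $n$-rectifiable and $\theta\in L^1_{\rm loc}(M,\sigma^n)$ nonnegative-integer valued; $\operatorname{Tan}(\mu,x)=\operatorname{Tan}(M,x)$. **First variation.** For $X\in C^1_c(U;\mathbf R^{n,m})$, $\operatorname{Div}_\mu X=\sum_{i=1}^n\langle\tau_i,\nabla_{\tau_i}X\rangle$ with $\{\tau_i\}$ an orthonormal basis of $\operatorname{Tan}(\mu,x)$, and $\delta V(X)=\int\operatorname{Div}_\mu X\,d\mu$. It is locally bounded if for each $K\Subset U$ there is $c_K$ with $|\delta V(X)|\le c_K\sup_K|X|_E$ whenever $\operatorname{spt}X\subset K$. Then $\delta V(X)=\int\langle X,\tilde\eta\rangle_E\,d|\delta V|$ with $|\tilde\eta|_E=1$ (Riesz) and $|\delta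 V|=f\mu+\beta$ with $\beta$ singular to $\mu$ (Radon–Nikodym). With $\xi=\operatorname{diag}(1,\dots,1,-1,\dots,-1)$ put $H=-\xi f\tilde\eta$, $\eta=\xi\tilde\eta$, so $\int\operatorname{Div}_\mu X\,d\mu=-\int\langle H,X\rangle\,d\mu+\int\langle X,\eta\rangle\,d\beta$. **The class $S\mathscr V_n(U,\Gamma)$** ($\Gamma$ a properly embedded $(n-1)$-dimensional spacelike submanifold of $U$): spacelike integer $n$-rectifiable Radon measures $\mu$ on $U$ with locally bounded first variation such that (1) $H(x)\in\operatorname{Tan}(\mu,x)^\perp$ for $\mu$-a.e. $x$; (2) $\eta(x)\in\operatorname{Tan}(\Gamma,x)^\perp$ is spacelike for $\beta$-a.e. $x$; (3) $\sqrt{\langle\eta,\eta\rangle}\,\beta\le\sigma^{n-1}\llcorner\Gamma$ (in particular $\operatorname{spt}\beta\subset\Gamma$). **Spacelike Brakke flow.** An $n$-dimensional spacelike Brakke flow with boundary $\Gamma$ in $U$ over an interval $I$ is a family $(\mu_t)_{t\in I}$ of Radon measures on $U$, where $\Gamma$ is a smooth, properly embedded $(n-1)$-dimensional spacelike submanifold of $U$, such that: (1) $\mu_t\in S\mathscr V_n(U,\Gamma)$ for a.e. $t\in I$; (2) $\int_a^b\int_K(1-\langle H,H\rangle)\,d\mu_tdt<\infty$ for $[a,b]\subset I$ and compact $K\subset U$; (3) for $[a,b]\subset I$ and $\phi\in C^2_c(U\times[a,b];\mathbf R^+)$, $\mu_b(\phi)-\mu_a(\phi)\ge\int_a^b\int\big(-\phi\langle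 H,H\rangle+\langle\nabla\phi,H\rangle+\partial_t\phi\big)\,d\mu_tdt$. Here $H=H(\mu_t,\cdot)$ and $\mu(\phi)=\int\phi\,d\mu$. $v^2(\mu_t,x)=v^2(\operatorname{Tan}(\mu_t,x))$ if $\mu_t\in S\mathscr V_n(U,\Gamma)$ and the tangent plane exists, and $v^2(\mu_t,x)=m$ otherwise. *)

theory Defs
  imports "HOL-Analysis.Analysis"
begin

section \<open>Minkowski space\<close>

text \<open>
  The coordinates of \<open>R^{n,m}\<close> are indexed by the sum type: \<^term>\<open>Inl i\<close> are the \<open>n\<close> positive
  directions, \<^term>\<open>Inr j\<close> the \<open>m\<close> negative ones.  The Euclidean structure is the library's one.
\<close>

type_synonym ('n, 'm) mink = "real ^ ('n + 'm)"

definition lip :: "('n::finite, 'm::finite) mink \<Rightarrow> ('n, 'm) mink \<Rightarrow> real" where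
  "lip u w = (\<Sum>i\<in>UNIV. u $ Inl i * w $ Inl i) - (\<Sum>j\<in>UNIV. u $ Inr j * w $ Inr j)"

definition reflect :: "('n::finite, 'm::finite) mink \<Rightarrow> ('n, 'm) mink" where
  "reflect u = (\<chi> k. case k of Inl i \<Rightarrow> u $ Inl i | Inr j \<Rightarrow> - u $ Inr j)"

definition spacelike_vector :: "('n::finite, 'm::finite) mink \<Rightarrow> bool" where
  "spacelike_vector u \<longleftrightarrow> lip u u > 0 \<or> u = 0"

definition spacelike_subspace :: "('n::finite, 'm::finite) mink set \<Rightarrow> bool" where
  "spacelike_subspace P \<longleftrightarrow> subspace P \<and> (\<forall>u\<in>P. u \<noteq> 0 \<longrightarrow> lip u u > 0)"

definition perp :: "('n::finite, 'm::finite) mink set \<Rightarrow> ('n, 'm) mink set" where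
  "perp P = {w. \<forall>u\<in>P. lip u w = 0}"

definition proj_perp :: "('n::finite, 'm::finite) mink set \<Rightarrow> ('n, 'm) mink \<Rightarrow> ('n, 'm) mink" where
  "proj_perp P u = (THE w. w \<in> perp P \<and> u - w \<in> P)"

definition lip_orthonormal_basis :: "('n::finite, 'm::finite) mink set \<Rightarrow> ('n, 'm) mink set \<Rightarrow> bool" where
  "lip_orthonormal_basis P B \<longleftrightarrow>
     B \<subseteq> P \<and> span B = P \<and> (\<forall>u\<in>B. lip u u = 1) \<and> pairwise (\<lambda>u w. lip u w = 0) B"

text \<open>The gradient with respect to \<^const>\<open>lip\<close> (not the Euclidean one).\<close>

definition lip_gradient :: "(('n::finite, 'm::finite) mink \<Rightarrow> real) \<Rightarrow> ('n, 'm) mink \<Rightarrow> ('n, 'm) mink" where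
  "lip_gradient f x = (THE v. \<forall>w. lip v w = frechet_derivative f (at x) w)"

definition gradient_sq :: "('n::finite, 'm::finite) mink set \<Rightarrow> real" where
  "gradient_sq P =
     (\<Sum>j\<in>UNIV. - lip (proj_perp P (axis (Inr j) 1)) (proj_perp P (axis (Inr j) 1)))"

text \<open>
  The determinant of a bilinear form in a basis given as a list, by the Leibniz formula (the
  dimension of the plane is \<open>n\<close> or \<open>n - 1\<close>, so it is not the cardinality of one fixed type).
  The quotient in \<open>area_factor\<close> does not depend on the basis.
\<close>

definition gram_det :: "('a \<Rightarrow> 'a \<Rightarrow> real) \<Rightarrow> 'a list \<Rightarrow> real" where
  "gram_det B b = (\<Sum>p | p permutes {..<length b}.
                     of_int (sign p) * (\<Prod>i<length b. B (b ! i) (b ! p i)))"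

definition area_factor :: "('n::finite, 'm::finite) mink set \<Rightarrow> real" where
  "area_factor P =
     (let b = (SOME b. distinct b \<and> independent (set b) \<and> span (set b) = P)
      in sqrt (gram_det lip b) / sqrt (gram_det (\<bullet>) b))"


section \<open>Differentiability classes and submanifolds\<close>

definition spt :: "('a::topological_space \<Rightarrow> 'b::zero) \<Rightarrow> 'a set" where
  "spt f = closure {x. f x \<noteq> 0}"

text \<open>
  To be used on open sets of finite-dimensional spaces, where continuity (resp. being \<open>C\<^sup>k\<close>) of all
  directional derivatives is the same as that of the derivative as a map into the space of linear maps.
\<close>

primrec Ck_on :: "nat \<Rightarrow> ('a::real_normed_vector \<Rightarrow> 'b::real_normed_vector) \<Rightarrow> 'a set \<Rightarrow> bool" where
  "Ck_on 0 f S \<longleftrightarrow> continuous_on S f"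
| "Ck_on (Suc k) f S \<longleftrightarrow>
     (\<forall>x\<in>S. f differentiable (at x)) \<and> (\<forall>v. Ck_on k (\<lambda>x. frechet_derivative f (at x) v) S)"

text \<open>\<open>C\<^sup>k\<^sub>c(U)\<close>; its elements are identified with their extensions by zero.\<close>

definition Ck_compact :: "nat \<Rightarrow> 'a set \<Rightarrow> ('a::real_normed_vector \<Rightarrow> 'b::real_normed_vector) set" where
  "Ck_compact k U = {f. Ck_on k f UNIV \<and> compact (spt f) \<and> spt f \<subseteq> U}"

text \<open>Embedded \<open>d\<close>-dimensional \<open>C\<^sup>r\<close> submanifolds (without boundary) by slice charts; \<open>r = \<infinity>\<close> is smooth.\<close>

definition submanifold :: "enat \<Rightarrow> nat \<Rightarrow> 'a::euclidean_space set \<Rightarrow> bool" where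
  "submanifold r d N \<longleftrightarrow>
     (\<forall>x\<in>N. \<exists>V W L. \<exists>F G::'a \<Rightarrow> 'a. open V \<and> x \<in> V \<and> open W \<and> homeomorphism V W F G
        \<and> (\<forall>k. enat k \<le> r \<longrightarrow> Ck_on k F V \<and> Ck_on k G W)
        \<and> subspace L \<and> dim L = d \<and> F ` (N \<inter> V) = L \<inter> W)"

definition tangent_space :: "'a::euclidean_space set \<Rightarrow> 'a \<Rightarrow> 'a set" where
  "tangent_space N x =
     {v. \<exists>c::real \<Rightarrow> 'a. c 0 = x \<and> range c \<subseteq> N \<and> (c has_vector_derivative v) (at 0)}"

definition properly_embedded_spacelike :: "('n::finite, 'm::finite) mink set \<Rightarrow> nat \<Rightarrow> ('n, 'm) mink set \<Rightarrow> bool" where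
  "properly_embedded_spacelike U d N \<longleftrightarrow>
     submanifold \<infinity> d N \<and> closedin (top_of_set U) N \<and> (\<forall>x\<in>N. spacelike_subspace (tangent_space N x))"

definition hessian_norm :: "('a::euclidean_space \<Rightarrow> real) \<Rightarrow> 'a \<Rightarrow> real" where
  "hessian_norm f x =
     sqrt (\<Sum>i\<in>Basis. \<Sum>j\<in>Basis.
       (frechet_derivative (\<lambda>y. frechet_derivative f (at y) i) (at x) j)\<^sup>2)"


section \<open>Hausdorff measure\<close>

text \<open>The empty set must cost nothing even for \<open>k = 0\<close>, where \<open>0 ^ 0 = 1\<close>.\<close>

definition hausdorff_cost :: "nat \<Rightarrow> 'a::metric_space set \<Rightarrow> ennreal" where
  "hausdorff_cost k C =
     (if C = {} then 0 else ennreal (unit_ball_vol (real k) * (diameter C / 2) ^ k))"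

definition hausdorff_pre :: "nat \<Rightarrow> real \<Rightarrow> 'a::metric_space set \<Rightarrow> ennreal" where
  "hausdorff_pre k \<delta> A =
     (INF C\<in>{C::nat \<Rightarrow> 'a set. A \<subseteq> (\<Union>i. C i) \<and> (\<forall>i. bounded (C i) \<and> diameter (C i) \<le> \<delta>)}.
        \<Sum>i. hausdorff_cost k (C i))"

definition hausdorff_outer :: "nat \<Rightarrow> 'a::metric_space set \<Rightarrow> ennreal" where
  "hausdorff_outer k A = (SUP \<delta>\<in>{0<..}. hausdorff_pre k \<delta> A)"

definition hausdorff_measure :: "nat \<Rightarrow> 'a::metric_space measure" where
  "hausdorff_measure k =
     measure_of UNIV (lambda_system UNIV UNIV (hausdorff_outer k)) (hausdorff_outer k)"

lemma hausdorff_pre_empty: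
  assumes "\<delta> > 0"
  shows "hausdorff_pre k \<delta> {} = 0"
proof -
  have "hausdorff_pre k \<delta> ({}::'a set) \<le> (\<Sum>i. hausdorff_cost k ((\<lambda>i::nat. {}::'a set) i))"
    unfolding hausdorff_pre_def using assms by (intro INF_lower) (auto simp: diameter_def)
  then show ?thesis
    by (simp add: hausdorff_cost_def)
qed

lemma hausdorff_pre_mono: "A \<subseteq> B \<Longrightarrow> hausdorff_pre k \<delta> A \<le> hausdorff_pre k \<delta> B"
  unfolding hausdorff_pre_def by (intro INF_superset_mono) auto

lemma hausdorff_pre_countably_subadditive:
  "hausdorff_pre k \<delta> (\<Union>i. A i) \<le> (\<Sum>i. hausdorff_pre k \<delta> (A i))"
proof (rule ennreal_le_epsilon)
  fix e :: real
  assume "e > 0" and fin: "(\<Sum>i. hausdorff_pre k \<delta> (A i)) < top"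
  define e' where "e' i = e * (1/2) ^ Suc i" for i :: nat
  have e': "e' i > 0" for i
    using \<open>e > 0\<close> by (simp add: e'_def)
  have "\<exists>C. A i \<subseteq> (\<Union>j. C j) \<and> (\<forall>j. bounded (C j) \<and> diameter (C j) \<le> \<delta>)
          \<and> (\<Sum>j. hausdorff_cost k (C j)) < hausdorff_pre k \<delta> (A i) + ennreal (e' i)" for i
  proof -
    have "hausdorff_pre k \<delta> (A i) < top"
      using fin ennreal_suminf_lessD by blast
    then have "hausdorff_pre k \<delta> (A i) < hausdorff_pre k \<delta> (A i) + ennreal (e' i)"
      using e'[of i] ennreal_add_left_cancel_less[of "hausdorff_pre k \<delta> (A i)" 0 "ennreal (e' i)"]
      by (auto simp: less_top)
    then have "(INF C\<in>{C::nat \<Rightarrow> 'a set. A i \<subseteq> (\<Union>i. C i) \<and> (\<forall>i. bounded (C i) \<and> diameter (C i) \<le> \<delta>)}.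
        \<Sum>i. hausdorff_cost k (C i)) < hausdorff_pre k \<delta> (A i) + ennreal (e' i)"
      by (simp only: hausdorff_pre_def[of k \<delta> "A i", symmetric])
    then show ?thesis
      unfolding INF_less_iff by auto
  qed
  then obtain C where C: "\<And>i. A i \<subseteq> (\<Union>j. C i j)"
      "\<And>i j. bounded (C i j)" "\<And>i j. diameter (C i j) \<le> \<delta>"
      "\<And>i. (\<Sum>j. hausdorff_cost k (C i j)) < hausdorff_pre k \<delta> (A i) + ennreal (e' i)"
    by metis
  define D where "D = (\<lambda>p. case prod_decode p of (i, j) \<Rightarrow> C i j)"
  have "(\<Union>i. A i) \<subseteq> (\<Union>p. D p)"
  proof
    fix x assume "x \<in> (\<Union>i. A i)"
    then obtain i j where "x \<in> C i j"
      using C(1) by blast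
    then have "x \<in> D (prod_encode (i, j))"
      by (simp add: D_def)
    then show "x \<in> (\<Union>p. D p)"
      by blast
  qed
  then have "hausdorff_pre k \<delta> (\<Union>i. A i) \<le> (\<Sum>p. hausdorff_cost k (D p))"
    unfolding hausdorff_pre_def using C(2,3)
    by (intro INF_lower) (auto simp: D_def split: prod.split)
  also have "\<dots> = (\<Sum>i. \<Sum>j. hausdorff_cost k (C i j))"
    using suminf_ennreal_2dimen[of "\<lambda>i. \<Sum>j. hausdorff_cost k (C i j)" "\<lambda>(i, j). hausdorff_cost k (C i j)"]
    by (simp add: D_def comp_def split_def)
  also have "\<dots> \<le> (\<Sum>i. hausdorff_pre k \<delta> (A i) + ennreal (e' i))"
    using C(4) by (intro suminf_le) (auto simp: less_imp_le)
  also have "\<dots> = (\<Sum>i. hausdorff_pre k \<delta> (A i)) + (\<Sum>i. ennreal (e' i))"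
    by (rule suminf_add[symmetric]) auto
  also have "(\<Sum>i. ennreal (e' i)) = ennreal e"
    using sums_mult[OF power_half_series, of e] \<open>e > 0\<close>
    by (intro suminf_ennreal_eq) (auto simp: e'_def)
  finally show "hausdorff_pre k \<delta> (\<Union>i. A i) \<le> (\<Sum>i. hausdorff_pre k \<delta> (A i)) + ennreal e" .
qed

lemma outer_measure_space_hausdorff:
  "outer_measure_space UNIV (hausdorff_outer k :: 'a::metric_space set \<Rightarrow> ennreal)"
  unfolding outer_measure_space_def
proof (intro conjI)
  show "positive UNIV (hausdorff_outer k :: 'a set \<Rightarrow> ennreal)"
    by (simp add: positive_def hausdorff_outer_def hausdorff_pre_empty)
  show "increasing UNIV (hausdorff_outer k :: 'a set \<Rightarrow> ennreal)"
    unfolding increasing_def hausdorff_outer_def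
    by (auto intro!: SUP_mono hausdorff_pre_mono)
  show "countably_subadditive UNIV (hausdorff_outer k :: 'a set \<Rightarrow> ennreal)"
    unfolding countably_subadditive_def
  proof (intro allI impI)
    fix A :: "nat \<Rightarrow> 'a set"
    show "hausdorff_outer k (\<Union>i. A i) \<le> (\<Sum>i. hausdorff_outer k (A i))"
      unfolding hausdorff_outer_def[of k "\<Union>i. A i"]
    proof (rule SUP_least)
      fix \<delta> :: real assume "\<delta> \<in> {0<..}"
      then have "hausdorff_pre k \<delta> (A i) \<le> hausdorff_outer k (A i)" for i
        unfolding hausdorff_outer_def by (rule SUP_upper)
      then show "hausdorff_pre k \<delta> (\<Union>i. A i) \<le> (\<Sum>i. hausdorff_outer k (A i))"
        using hausdorff_pre_countably_subadditive[of k \<delta> A]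
        by (blast intro: order_trans suminf_le summableI)
    qed
  qed
qed

lemma measure_space_hausdorff:
  "measure_space UNIV (lambda_system UNIV UNIV (hausdorff_outer k)) (hausdorff_outer k)"
  using sigma_algebra.caratheodory_lemma[OF sigma_algebra_Pow, of UNIV "hausdorff_outer k"]
    outer_measure_space_hausdorff[of k] by simp

lemma sets_hausdorff_measure:
  "sets (hausdorff_measure k :: 'a::metric_space measure) = lambda_system UNIV UNIV (hausdorff_outer k)"
proof -
  have "sigma_algebra UNIV (lambda_system UNIV UNIV (hausdorff_outer k :: 'a set \<Rightarrow> ennreal))"
    using measure_space_hausdorff[of k, where ?'a = 'a] by (simp add: measure_space_def)
  then show ?thesis
    unfolding hausdorff_measure_def by (rule sigma_algebra.sets_measure_of_eq)
qed

lemma emeasure_hausdorff_measure: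
  assumes "A \<in> sets (hausdorff_measure k)"
  shows "emeasure (hausdorff_measure k) A = hausdorff_outer k A"
  by (rule emeasure_measure_of[OF hausdorff_measure_def])
     (use assms measure_space_hausdorff[of k] in \<open>auto simp: sets_hausdorff_measure measure_space_def\<close>)


section \<open>Rectifiable sets and the area measure\<close>

definition rectifiable :: "nat \<Rightarrow> 'a::euclidean_space set \<Rightarrow> bool" where
  "rectifiable k M \<longleftrightarrow> M \<in> sets (hausdorff_measure k) \<and>
     (\<exists>N::nat \<Rightarrow> 'a set. (\<forall>i. submanifold 1 k (N i)) \<and> hausdorff_outer k (M - (\<Union>i. N i)) = 0)"

text \<open>
  \<open>P\<close> is the limit of the blow-ups of \<open>M\<close> at \<open>x\<close>, where \<open>M\<close> carries the Hausdorff measure with weight \<open>w\<close>.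
\<close>

definition approx_tangent_plane ::
    "nat \<Rightarrow> 'a::euclidean_space set \<Rightarrow> ('a \<Rightarrow> real) \<Rightarrow> 'a \<Rightarrow> 'a set \<Rightarrow> bool" where
  "approx_tangent_plane k M w x P \<longleftrightarrow> subspace P \<and> dim P = k \<and>
     (\<forall>f::'a \<Rightarrow> real. continuous_on UNIV f \<and> compact (spt f) \<longrightarrow>
        ((\<lambda>r. (LINT y:M|hausdorff_measure k. f ((y - x) /\<^sub>R r) * w y) / r ^ k)
           \<longlongrightarrow> w x * (LINT y:P|hausdorff_measure k. f y)) (at_right 0))"

text \<open>
  \<open>T = Tan(M,\<cdot>)\<close>.  A rectifiable set need not have locally finite Hausdorff measure, so tangent planes
  are taken with respect to some positive, locally integrable weight on \<open>M\<close>.  Every rectifiable set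
  has a tangent field, and it is unique up to null sets (in particular it does not depend on the weight).
\<close>

definition tangent_field :: "nat \<Rightarrow> 'a::euclidean_space set \<Rightarrow> ('a \<Rightarrow> 'a set) \<Rightarrow> bool" where
  "tangent_field k M T \<longleftrightarrow>
     (\<exists>w::'a \<Rightarrow> real. w \<in> borel_measurable (hausdorff_measure k) \<and> (\<forall>x\<in>M. w x > 0) \<and>
        (\<forall>K. compact K \<longrightarrow> (\<integral>\<^sup>+x\<in>K \<inter> M. ennreal (w x) \<partial>hausdorff_measure k) < \<infinity>) \<and>
        (AE x in hausdorff_measure k. x \<in> M \<longrightarrow> approx_tangent_plane k M w x (T x)))"

text \<open>\<open>\<sigma>\<^sup>k\<close> restricted to \<open>M\<close>, where \<open>T\<close> assigns the tangent planes of \<open>M\<close>.\<close>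

definition area_measure ::
    "nat \<Rightarrow> ('n::finite, 'm::finite) mink set \<Rightarrow> (('n, 'm) mink \<Rightarrow> ('n, 'm) mink set) \<Rightarrow> ('n, 'm) mink measure" where
  "area_measure k M T =
     density (hausdorff_measure k) (\<lambda>x. indicator M x * ennreal (area_factor (T x)))"


section \<open>Spacelike integer rectifiable measures\<close>

text \<open>
  Measures on \<open>U\<close> have \<^term>\<open>U\<close> as their space and its Borel sets as measurable sets.  For open \<open>U\<close>
  regularity follows from finiteness on compact sets.
\<close>

definition radon_measure :: "'a::euclidean_space set \<Rightarrow> 'a measure \<Rightarrow> bool" where
  "radon_measure U \<mu> \<longleftrightarrow>
     sets \<mu> = sets (restrict_space borel U) \<and> (\<forall>K. compact K \<and> K \<subseteq> U \<longrightarrow> emeasure \<mu> K < \<infinity>)"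

definition spacelike_representation ::
    "('n::finite, 'm::finite) mink set \<Rightarrow> ('n, 'm) mink measure \<Rightarrow>
     ('n, 'm) mink set \<Rightarrow> (('n, 'm) mink \<Rightarrow> ('n, 'm) mink set) \<Rightarrow> (('n, 'm) mink \<Rightarrow> nat) \<Rightarrow> bool" where
  "spacelike_representation U \<mu> M T \<theta> \<longleftrightarrow>
     M \<subseteq> U \<and> rectifiable CARD('n) M \<and> tangent_field CARD('n) M T \<and>
     (AE x in hausdorff_measure CARD('n). x \<in> M \<longrightarrow> spacelike_subspace (T x)) \<and>
     \<theta> \<in> measurable (restrict_space (hausdorff_measure CARD('n)) M) (count_space UNIV) \<and>
     (\<forall>K. compact K \<and> K \<subseteq> U \<longrightarrow> (\<integral>\<^sup>+x\<in>K. of_nat (\<theta> x) \<partial>area_measure CARD('n) M T) < \<infinity>) \<and>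
     (\<forall>A\<in>sets \<mu>. emeasure \<mu> A = (\<integral>\<^sup>+x\<in>A. of_nat (\<theta> x) \<partial>area_measure CARD('n) M T))"

definition spacelike_integer_rectifiable ::
    "('n::finite, 'm::finite) mink set \<Rightarrow> ('n, 'm) mink measure \<Rightarrow> bool" where
  "spacelike_integer_rectifiable U \<mu> \<longleftrightarrow>
     radon_measure U \<mu> \<and> (\<exists>M T \<theta>. spacelike_representation U \<mu> M T \<theta>)"

text \<open>
  \<open>Tan(\<mu>,\<cdot>)\<close>.  Two representations of \<open>\<mu>\<close> have the same tangent planes \<open>\<mu>\<close>-almost everywhere.
\<close>

definition Tan :: "('n::finite, 'm::finite) mink set \<Rightarrow> ('n, 'm) mink measure \<Rightarrow> ('n, 'm) mink \<Rightarrow> ('n, 'm) mink set" where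
  "Tan U \<mu> = (SOME T. \<exists>M \<theta>. spacelike_representation U \<mu> M T \<theta>)"


section \<open>First variation\<close>

definition divergence :: "('n::finite, 'm::finite) mink set \<Rightarrow> (('n, 'm) mink \<Rightarrow> ('n, 'm) mink) \<Rightarrow> ('n, 'm) mink \<Rightarrow> real" where
  "divergence P X x =
     (let B = (SOME B. lip_orthonormal_basis P B)
      in \<Sum>\<tau>\<in>B. lip \<tau> (frechet_derivative X (at x) \<tau>))"

text \<open>
  \<^term>\<open>Tan U \<mu>\<close> is only determined up to a null set, which need not be Borel; hence the completion.
\<close>

definition first_variation ::
    "('n::finite, 'm::finite) mink set \<Rightarrow> ('n, 'm) mink measure \<Rightarrow> (('n, 'm) mink \<Rightarrow> ('n, 'm) mink) \<Rightarrow> real" where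
  "first_variation U \<mu> X = (\<integral>x. divergence (Tan U \<mu> x) X x \<partial>completion \<mu>)"

text \<open>
  The divergence of a test field is not bounded where the tangent planes degenerate, so finiteness
  of the integral is a condition.
\<close>

definition locally_bounded_first_variation ::
    "('n::finite, 'm::finite) mink set \<Rightarrow> ('n, 'm) mink measure \<Rightarrow> bool" where
  "locally_bounded_first_variation U \<mu> \<longleftrightarrow>
     (\<forall>X\<in>Ck_compact 1 U. integrable (completion \<mu>) (\<lambda>x. divergence (Tan U \<mu> x) X x)) \<and>
     (\<forall>K. compact (closure K) \<and> closure K \<subseteq> U \<longrightarrow>
        (\<exists>c. \<forall>X\<in>Ck_compact 1 U. spt X \<subseteq> K \<longrightarrow> \<bar>first_variation U \<mu> X\<bar> \<le> c * (SUP x\<in>K. norm (X x))))"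

text \<open>
  The Riesz representation of the first variation by its total variation measure \<open>\<nu>\<close> and \<open>\<zeta>\<close>
  (Euclidean unit length), and the Lebesgue decomposition \<open>\<nu> = f \<mu> + \<beta>\<close>.  The measures \<open>\<nu>\<close>, \<open>\<beta>\<close> are
  unique, \<open>\<zeta>\<close> is unique \<open>\<nu>\<close>-a.e. and \<open>f\<close> is unique \<open>\<mu>\<close>-a.e.
\<close>

definition variation_decomposition ::
    "('n::finite, 'm::finite) mink set \<Rightarrow> ('n, 'm) mink measure \<Rightarrow> ('n, 'm) mink measure \<Rightarrow>
     (('n, 'm) mink \<Rightarrow> ('n, 'm) mink) \<Rightarrow> (('n, 'm) mink \<Rightarrow> real) \<Rightarrow> ('n, 'm) mink measure \<Rightarrow> bool" where
  "variation_decomposition U \<mu> \<nu> \<zeta> f \<beta> \<longleftrightarrow>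
     radon_measure U \<nu> \<and> \<zeta> \<in> borel_measurable borel \<and> (AE x in \<nu>. norm (\<zeta> x) = 1) \<and>
     (\<forall>X\<in>Ck_compact 1 U. first_variation U \<mu> X = (\<integral>x. X x \<bullet> \<zeta> x \<partial>\<nu>)) \<and>
     radon_measure U \<beta> \<and> f \<in> borel_measurable borel \<and> (\<forall>x. f x \<ge> 0) \<and>
     (\<forall>A\<in>sets \<mu>. emeasure \<nu> A = (\<integral>\<^sup>+x\<in>A. ennreal (f x) \<partial>\<mu>) + emeasure \<beta> A) \<and>
     (\<exists>N\<in>sets \<mu>. emeasure \<mu> N = 0 \<and> emeasure \<beta> (U - N) = 0)"

definition mean_curvature ::
    "('n::finite, 'm::finite) mink set \<Rightarrow> ('n, 'm) mink measure \<Rightarrow> ('n, 'm) mink \<Rightarrow> ('n, 'm) mink" where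
  "mean_curvature U \<mu> =
     (SOME H. \<exists>\<nu> \<zeta> f \<beta>. variation_decomposition U \<mu> \<nu> \<zeta> f \<beta> \<and> H = (\<lambda>x. - (f x *\<^sub>R reflect (\<zeta> x))))"

definition boundary_normal ::
    "('n::finite, 'm::finite) mink set \<Rightarrow> ('n, 'm) mink measure \<Rightarrow> ('n, 'm) mink \<Rightarrow> ('n, 'm) mink" where
  "boundary_normal U \<mu> =
     (SOME \<eta>. \<exists>\<nu> \<zeta> f \<beta>. variation_decomposition U \<mu> \<nu> \<zeta> f \<beta> \<and> \<eta> = (\<lambda>x. reflect (\<zeta> x)))"

definition boundary_measure ::
    "('n::finite, 'm::finite) mink set \<Rightarrow> ('n, 'm) mink measure \<Rightarrow> ('n, 'm) mink measure" where
  "boundary_measure U \<mu> = (SOME \<beta>. \<exists>\<nu> \<zeta> f. variation_decomposition U \<mu> \<nu> \<zeta> f \<beta>)"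

definition SV :: "('n::finite, 'm::finite) mink set \<Rightarrow> ('n, 'm) mink set \<Rightarrow> ('n, 'm) mink measure set" where
  "SV U \<Gamma> = {\<mu>.
     spacelike_integer_rectifiable U \<mu> \<and>
     locally_bounded_first_variation U \<mu> \<and>
     (AE x in \<mu>. mean_curvature U \<mu> x \<in> perp (Tan U \<mu> x)) \<and>
     (AE x in boundary_measure U \<mu>.
        boundary_normal U \<mu> x \<in> perp (tangent_space \<Gamma> x) \<and> spacelike_vector (boundary_normal U \<mu> x)) \<and>
     (\<forall>A\<in>sets \<mu>.
        (\<integral>\<^sup>+x\<in>A. ennreal (sqrt (lip (boundary_normal U \<mu> x) (boundary_normal U \<mu> x))) \<partial>boundary_measure U \<mu>)
          \<le> emeasure (area_measure (CARD('n) - 1) \<Gamma> (tangent_space \<Gamma>)) A)}"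

definition gradient_function ::
    "('n::finite, 'm::finite) mink set \<Rightarrow> ('n, 'm) mink set \<Rightarrow> ('n, 'm) mink measure \<Rightarrow> ('n, 'm) mink \<Rightarrow> real" where
  "gradient_function U \<Gamma> \<mu> x =
     (if \<mu> \<in> SV U \<Gamma> \<and> spacelike_subspace (Tan U \<mu> x) \<and> dim (Tan U \<mu> x) = CARD('n)
      then gradient_sq (Tan U \<mu> x) else real CARD('m))"


section \<open>Spacelike Brakke flow\<close>

text \<open>
  \<open>C\<^sup>2\<^sub>c(U \<times> [a,b]; [0,\<infinity>))\<close>: compact support in \<open>U \<times> [a,b]\<close>, not necessarily vanishing at the end
  points.  Every \<open>C\<^sup>2\<close> function on \<open>U \<times> [a,b]\<close> with compact support is the restriction of
  a \<open>C\<^sup>2\<close> function on the whole space-time; only the values for times in \<open>[a,b]\<close> matter.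
\<close>

definition spacetime_test :: "'a::euclidean_space set \<Rightarrow> real \<Rightarrow> real \<Rightarrow> ('a \<times> real \<Rightarrow> real) set" where
  "spacetime_test U a b = {\<phi>. Ck_on 2 \<phi> UNIV \<and> (\<forall>x. \<forall>t\<in>{a..b}. \<phi> (x, t) \<ge> 0) \<and>
     (let S = closure {(x, t). t \<in> {a..b} \<and> \<phi> (x, t) \<noteq> 0} in compact S \<and> S \<subseteq> U \<times> {a..b})}"

definition brakke_integrand ::
    "('n::finite, 'm::finite) mink set \<Rightarrow> ('n, 'm) mink measure \<Rightarrow> (('n, 'm) mink \<times> real \<Rightarrow> real) \<Rightarrow>
     real \<Rightarrow> ('n, 'm) mink \<Rightarrow> real" where
  "brakke_integrand U \<mu> \<phi> t x =
     (let H = mean_curvature U \<mu> x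
      in - \<phi> (x, t) * lip H H + lip (lip_gradient (\<lambda>y. \<phi> (y, t)) x) H + deriv (\<lambda>s. \<phi> (x, s)) t)"

text \<open>
  The time integrals are Lebesgue integrals, so their integrands are measurable in time.  In the last
  clause the double integral may be infinite: with \<open>g\<close> its inner integral, \<open>\<mu>\<^sub>b(\<phi>) - \<mu>\<^sub>a(\<phi>) \<ge> \<integral>g\<close> is written as
  \<open>\<mu>\<^sub>a(\<phi>) + \<integral>g\<^sup>+ \<le> \<mu>\<^sub>b(\<phi>) + \<integral>g\<^sup>-\<close> in \<open>[0,\<infinity>]\<close> (\<^const>\<open>ennreal\<close> maps negative numbers to 0).
\<close>

definition spacelike_brakke_flow ::
    "('n::finite, 'm::finite) mink set \<Rightarrow> ('n, 'm) mink set \<Rightarrow> real set \<Rightarrow> (real \<Rightarrow> ('n, 'm) mink measure) \<Rightarrow> bool" where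
  "spacelike_brakke_flow U \<Gamma> I \<mu> \<longleftrightarrow>
     properly_embedded_spacelike U (CARD('n) - 1) \<Gamma> \<and>
     (\<forall>t\<in>I. radon_measure U (\<mu> t)) \<and>
     (AE t in lebesgue_on I. \<mu> t \<in> SV U \<Gamma>) \<and>
     (\<forall>a b K. a \<le> b \<and> {a..b} \<subseteq> I \<and> compact K \<and> K \<subseteq> U \<longrightarrow>
        (let g = (\<lambda>t. \<integral>\<^sup>+x\<in>K. ennreal (1 - lip (mean_curvature U (\<mu> t) x) (mean_curvature U (\<mu> t) x)) \<partial>\<mu> t)
         in g \<in> borel_measurable (lebesgue_on {a..b}) \<and> (\<integral>\<^sup>+t. g t \<partial>lebesgue_on {a..b}) < \<infinity>)) \<and>
     (\<forall>a b. \<forall>\<phi>\<in>spacetime_test U a b. a \<le> b \<and> {a..b} \<subseteq> I \<longrightarrow>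
        (let g = (\<lambda>t. \<integral>x. brakke_integrand U (\<mu> t) \<phi> t x \<partial>\<mu> t)
         in g \<in> borel_measurable (lebesgue_on {a..b}) \<and>
            ennreal (\<integral>x. \<phi> (x, a) \<partial>\<mu> a) + (\<integral>\<^sup>+t. ennreal (g t) \<partial>lebesgue_on {a..b})
              \<le> ennreal (\<integral>x. \<phi> (x, b) \<partial>\<mu> b) + (\<integral>\<^sup>+t. ennreal (- g t) \<partial>lebesgue_on {a..b})))"

definition gradient_bound ::
    "('n::finite, 'm::finite) mink set \<Rightarrow> ('n, 'm) mink set \<Rightarrow> real set \<Rightarrow> (real \<Rightarrow> ('n, 'm) mink measure) \<Rightarrow>
     (('n, 'm) mink \<Rightarrow> real) \<Rightarrow> ennreal" where
  "gradient_bound U \<Gamma> I \<mu> \<phi> =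
     (SUP t\<in>I. \<integral>\<^sup>+x\<in>spt \<phi>. ennreal (gradient_function U \<Gamma> (\<mu> t) x) \<partial>\<mu> t)"

end

theory Submission
  imports Defs
begin

text \<open>
  Almost everywhere the mean curvature \<open>H\<close> is orthogonal to a spacelike \<open>n\<close>-plane \<open>P\<close>, hence timelike.
  By Cauchy--Schwarz for \<open>- lip\<close> on \<open>P\<^sup>\<bottom>\<close>, its Euclidean length satisfies \<open>|H|\<^sup>2 \<le> 2 v\<^sup>2 (- lip H H)\<close>.
  Since \<open>|\<nabla>\<phi>|\<^sup>2 \<le> 2 \<phi> max |\<nabla>\<^sup>2\<phi>|\<close> for \<open>\<phi> \<ge> 0\<close>, the arithmetic-geometric mean inequality gives
  \<open>- \<phi> lip H H + lip \<nabla>\<phi> H \<ge> - v\<^sup>2 max |\<nabla>\<^sup>2\<phi>|\<close> pointwise, and the Brakke inequality for a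
  time-independent test function yields the claim, since \<open>m \<ge> 1\<close>.
\<close>

section \<open>Linear algebra of Minkowski space\<close>

lemma inner_mink_split:
  fixes u w :: "('n::finite, 'm::finite) mink"
  shows "u \<bullet> w = (\<Sum>i\<in>UNIV. u $ Inl i * w $ Inl i) + (\<Sum>j\<in>UNIV. u $ Inr j * w $ Inr j)"
proof -
  have "u \<bullet> w = (\<Sum>k\<in>UNIV <+> UNIV. u $ k * w $ k)"
    by (simp add: inner_vec_def)
  also have "\<dots> = (\<Sum>i\<in>UNIV. u $ Inl i * w $ Inl i) + (\<Sum>j\<in>UNIV. u $ Inr j * w $ Inr j)"
    by (subst sum.Plus) (auto simp: comp_def)
  finally show ?thesis .
qed

lemma reflect_nth [simp]: "reflect u $ Inl i = u $ Inl i" "reflect u $ Inr j = - u $ Inr j"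
  by (simp_all add: reflect_def)

lemma lip_eq_inner_reflect: "lip u w = reflect u \<bullet> w"
  by (simp add: lip_def inner_mink_split sum_negf)

lemma reflect_reflect [simp]: "reflect (reflect u) = u"
  by (auto simp: reflect_def vec_eq_iff split: sum.split)

lemma norm_reflect [simp]: "norm (reflect u) = norm u"
  by (simp add: norm_eq_sqrt_inner inner_mink_split)

lemma linear_reflect: "linear reflect"
  by (rule linearI) (auto simp: reflect_def vec_eq_iff split: sum.split)

lemma lip_commute: "lip u w = lip w u"
  by (simp add: lip_def mult.commute)

lemma lip_add: "lip (u + v) w = lip u w + lip v w" "lip w (u + v) = lip w u + lip w v"
  by (simp_all add: lip_eq_inner_reflect linear_add[OF linear_reflect] inner_simps)

lemma lip_scale: "lip (c *\<^sub>R u) w = c * lip u w" "lip w (c *\<^sub>R u) = c * lip w u"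
  by (simp_all add: lip_eq_inner_reflect linear_scale[OF linear_reflect] inner_simps)

lemma lip_diff: "lip (u - v) w = lip u w - lip v w" "lip w (u - v) = lip w u - lip w v"
  by (simp_all add: lip_eq_inner_reflect linear_diff[OF linear_reflect] inner_simps)

lemma lip_zero [simp]: "lip 0 w = 0" "lip w 0 = 0"
  by (simp_all add: lip_def)

lemma lip_le_norm: "\<bar>lip u w\<bar> \<le> norm u * norm w"
  using Cauchy_Schwarz_ineq2[of "reflect u" w] by (simp add: lip_eq_inner_reflect)

lemma subspace_perp: "subspace (perp P)"
  by (auto simp: subspace_def perp_def lip_add lip_scale)

lemma spacelike_Int_perp:
  assumes "spacelike_subspace P" "w \<in> P" "w \<in> perp P"
  shows "w = 0"
  using assms by (force simp: spacelike_subspace_def perp_def)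

lemma ex_spacelike_decomposition:
  fixes P :: "('n::finite, 'm::finite) mink set"
  assumes "spacelike_subspace P"
  shows "\<exists>w\<in>perp P. u - w \<in> P"
proof -
  have P: "subspace P"
    using assms by (simp add: spacelike_subspace_def)
  have "inj (reflect :: ('n, 'm) mink \<Rightarrow> _)"
    by (metis injI reflect_reflect)
  then have "dim (reflect ` P) = dim P"
    using linear_reflect by (intro dim_image_eq) (auto intro: inj_on_subset)
  moreover have "perp P = {y \<in> UNIV. \<forall>x\<in>reflect ` P. orthogonal x y}"
    by (auto simp: perp_def lip_eq_inner_reflect orthogonal_def)
  ultimately have "dim P + dim (perp P) = dim (UNIV :: ('n, 'm) mink set)"
    using dim_subspace_orthogonal_to_vectors[of "reflect ` P" UNIV]
      linear_subspace_image[OF linear_reflect P] by simp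
  moreover have "P \<inter> perp P = {0}"
    using spacelike_Int_perp[OF assms] subspace_0[OF P] subspace_0[OF subspace_perp] by blast
  ultimately have "dim {x + y |x y. x \<in> P \<and> y \<in> perp P} = dim (UNIV :: ('n, 'm) mink set)"
    using dim_sums_Int[OF P subspace_perp[of P]] by simp
  then have "{x + y |x y. x \<in> P \<and> y \<in> perp P} = UNIV"
    using dim_eq_full[of "{x + y |x y. x \<in> P \<and> y \<in> perp P}"]
      span_eq_iff[THEN iffD2, OF subspace_sums[OF P subspace_perp[of P]]] by simp
  then obtain x y where "u = x + y" "x \<in> P" "y \<in> perp P"
    by blast
  then show ?thesis
    by (intro bexI[of _ y]) auto
qed

lemma proj_perp:
  assumes "spacelike_subspace P"
  shows "proj_perp P u \<in> perp P" "u - proj_perp P u \<in> P"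
proof -
  have "\<exists>!w. w \<in> perp P \<and> u - w \<in> P"
  proof (rule ex_ex1I)
    fix w w' assume "w \<in> perp P \<and> u - w \<in> P" "w' \<in> perp P \<and> u - w' \<in> P"
    then have "w - w' \<in> perp P" "(u - w') - (u - w) \<in> P"
      using assms subspace_diff subspace_perp unfolding spacelike_subspace_def by blast+
    then show "w = w'"
      using spacelike_Int_perp[OF assms, of "w - w'"] by simp
  qed (use ex_spacelike_decomposition[OF assms, of u] in blast)
  from theI'[OF this] show "proj_perp P u \<in> perp P" "u - proj_perp P u \<in> P"
    unfolding proj_perp_def by blast+
qed

text \<open>The positive coordinates are injective on a spacelike subspace.\<close>

lemma dim_spacelike_le:
  fixes P :: "('n::finite, 'm::finite) mink set"
  assumes "spacelike_subspace P"
  shows "dim P \<le> CARD('n)"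
proof -
  define f where "f u = (\<chi> i. u $ Inl i)" for u :: "('n, 'm) mink"
  have f: "linear f"
    by (rule linearI) (auto simp: f_def vec_eq_iff)
  have P: "subspace P"
    using assms by (simp add: spacelike_subspace_def)
  have "u = 0" if "u \<in> P" "f u = 0" for u
  proof (rule ccontr)
    assume "u \<noteq> 0"
    then have "lip u u > 0"
      using assms that by (simp add: spacelike_subspace_def)
    moreover have "lip u u = - (\<Sum>j\<in>UNIV. (u $ Inr j)\<^sup>2)"
      using that(2) by (simp add: lip_def f_def vec_eq_iff power2_eq_square)
    moreover have "(\<Sum>j\<in>UNIV. (u $ Inr j)\<^sup>2) \<ge> 0"
      by (simp add: sum_nonneg)
    ultimately show False
      by simp
  qed
  then have "inj_on f P"
    using linear_inj_on_span_iff_independent_image linear_injective_on_subspace_0[OF f P] by blast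
  then have "dim (f ` P) = dim P"
    using f P by (intro dim_image_eq) (auto simp: span_eq_iff[THEN iffD2])
  then show ?thesis
    using dim_subset_UNIV[of "f ` P"] by simp
qed

lemma perp_spacelike_nonpos:
  fixes P :: "('n::finite, 'm::finite) mink set"
  assumes P: "spacelike_subspace P" "dim P = CARD('n)" and w: "w \<in> perp P"
  shows "lip w w \<le> 0"
proof (rule ccontr)
  assume pos: "\<not> lip w w \<le> 0"
  have sub: "subspace P"
    using P by (simp add: spacelike_subspace_def)
  have lip0: "lip p w = 0" "lip w p = 0" if "p \<in> P" for p
    using w that by (auto simp: perp_def lip_commute)
  have "lip u u > 0" if "u \<in> span (insert w P)" "u \<noteq> 0" for u
  proof -
    have "\<exists>c. u - c *\<^sub>R w \<in> P"
      using that(1) unfolding span_insert span_eq_iff[THEN iffD2, OF sub] by simp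
    then obtain c where c: "u - c *\<^sub>R w \<in> P"
      by blast
    define p where "p = u - c *\<^sub>R w"
    have u: "u = p + c *\<^sub>R w"
      by (simp add: p_def)
    have "lip u u = lip p p + c * c * lip w w"
      using lip0[OF c] by (simp add: u lip_add lip_scale p_def[symmetric])
    moreover have "p = 0 \<or> lip p p > 0"
      using P(1) c by (auto simp: spacelike_subspace_def p_def)
    moreover have "c \<noteq> 0" if "p = 0"
      using that u \<open>u \<noteq> 0\<close> by auto
    ultimately show ?thesis
      using pos by (smt (verit, best) lip_zero(1) mult_pos_pos zero_less_mult_iff mult_neg_neg
          mult_nonneg_nonneg zero_le_square)
  qed
  then have "spacelike_subspace (span (insert w P))"
    by (simp add: spacelike_subspace_def)
  then have "dim (insert w P) \<le> CARD('n)"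
    using dim_spacelike_le by fastforce
  moreover have "w \<notin> P"
    using pos lip0 by force
  then have "dim (insert w P) = CARD('n) + 1"
    using P(2) sub by (simp add: dim_insert span_eq_iff[THEN iffD2])
  ultimately show False
    by simp
qed

lemma lip_Cauchy_Schwarz_nonpos:
  assumes W: "subspace W" "\<And>w. w \<in> W \<Longrightarrow> lip w w \<le> 0" and a: "a \<in> W" and b: "b \<in> W"
  shows "(lip a b)\<^sup>2 \<le> lip a a * lip b b"
proof -
  have q: "lip a a + 2 * t * lip a b + t\<^sup>2 * lip b b \<le> 0" for t
  proof -
    have "lip (a + t *\<^sub>R b) (a + t *\<^sub>R b) \<le> 0"
      using W a b by (simp add: subspace_add subspace_scale)
    then show ?thesis
      by (simp add: lip_add lip_scale lip_commute[of b a] power2_eq_square algebra_simps)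
  qed
  show ?thesis
  proof (cases "lip b b = 0")
    case True
    have "lip a b = 0"
    proof (rule ccontr)
      assume "lip a b \<noteq> 0"
      then show False
        using q[of "(1 - lip a a) / (2 * lip a b)"] True \<open>lip a b \<noteq> 0\<close>
        by (simp add: diff_divide_distrib ring_distribs)
    qed
    then show ?thesis
      using True by simp
  next
    case False
    then have neg: "lip b b < 0"
      using W(2)[OF b] by simp
    have "(lip a a + 2 * (- lip a b / lip b b) * lip a b + (- lip a b / lip b b)\<^sup>2 * lip b b) * lip b b \<ge> 0"
      by (rule mult_nonpos_nonpos) (use q[of "- lip a b / lip b b"] neg in auto)
    then show ?thesis
      using neg by (simp add: power2_eq_square field_simps)
  qed
qed

lemma lip_proj_perp:
  assumes "spacelike_subspace P" "H \<in> perp P"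
  shows "lip H (proj_perp P u) = lip H u"
proof -
  have "lip (u - proj_perp P u) H = 0"
    using proj_perp(2)[OF assms(1)] assms(2) by (auto simp: perp_def)
  then show ?thesis
    by (simp add: lip_diff lip_commute)
qed

lemma gradient_sq_nonneg:
  fixes P :: "('n::finite, 'm::finite) mink set"
  assumes "spacelike_subspace P" "dim P = CARD('n)"
  shows "gradient_sq P \<ge> 0"
  unfolding gradient_sq_def
  using perp_spacelike_nonpos[OF assms] proj_perp(1)[OF assms(1)] by (intro sum_nonneg) auto

text \<open>
  The negative coordinates of \<open>H\<close> are its products with the \<open>e\<^sub>j\<close>, which may be replaced
  by their projections to \<open>P\<^sup>\<bottom>\<close>, where \<open>- lip\<close> is positive semidefinite.
\<close>

lemma norm_perp_le_gradient_sq: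
  fixes P :: "('n::finite, 'm::finite) mink set"
  assumes P: "spacelike_subspace P" "dim P = CARD('n)" and H: "H \<in> perp P"
  shows "(norm H)\<^sup>2 \<le> 2 * gradient_sq P * (- lip H H)"
proof -
  let ?e = "\<lambda>j. axis (Inr j) 1 :: ('n, 'm) mink"
  have neg: "lip H (?e j) = - H $ Inr j" for j
    by (simp add: lip_eq_inner_reflect inner_axis)
  have "(\<Sum>j\<in>UNIV. (H $ Inr j)\<^sup>2) = (\<Sum>j\<in>UNIV. (lip H (proj_perp P (?e j)))\<^sup>2)"
    by (simp add: lip_proj_perp[OF P(1) H] neg)
  also have "\<dots> \<le> (\<Sum>j\<in>UNIV. lip H H * lip (proj_perp P (?e j)) (proj_perp P (?e j)))"
    using lip_Cauchy_Schwarz_nonpos[OF subspace_perp perp_spacelike_nonpos[OF P] H proj_perp(1)[OF P(1)]]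
    by (intro sum_mono) auto
  also have "\<dots> = gradient_sq P * (- lip H H)"
    by (simp add: gradient_sq_def sum_distrib_left[symmetric] sum_negf mult.commute)
  finally have "(\<Sum>j\<in>UNIV. (H $ Inr j)\<^sup>2) \<le> gradient_sq P * (- lip H H)" .
  moreover have "(norm H)\<^sup>2 = lip H H + 2 * (\<Sum>j\<in>UNIV. (H $ Inr j)\<^sup>2)"
    unfolding power2_norm_eq_inner inner_mink_split lip_def by (simp add: power2_eq_square)
  ultimately show ?thesis
    using perp_spacelike_nonpos[OF P H] by simp
qed

lemma lip_perp_ge:
  fixes P :: "('n::finite, 'm::finite) mink set"
  assumes P: "spacelike_subspace P" "dim P = CARD('n)" and H: "H \<in> perp P"
    and "p \<ge> 0" "C \<ge> 0" and u: "(norm u)\<^sup>2 \<le> 2 * p * C"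
  shows "- p * lip H H + lip u H \<ge> - (C * gradient_sq P)"
proof -
  define q where "q = - lip H H"
  have nn: "q \<ge> 0" "gradient_sq P \<ge> 0"
    using perp_spacelike_nonpos[OF P H] gradient_sq_nonneg[OF P] by (auto simp: q_def)
  have "(norm u * norm H)\<^sup>2 \<le> (2 * p * C) * (2 * gradient_sq P * q)"
    using u norm_perp_le_gradient_sq[OF P H] unfolding power_mult_distrib q_def
    by (intro mult_mono) (use assms(4,5) in auto)
  also have "\<dots> \<le> (p * q + C * gradient_sq P)\<^sup>2"
    using zero_le_power2[of "p * q - C * gradient_sq P"]
    by (simp add: power2_eq_square algebra_simps)
  finally have "norm u * norm H \<le> p * q + C * gradient_sq P"
    by (rule power2_le_imp_le) (use nn assms(4,5) in auto)
  then show ?thesis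
    using lip_le_norm[of u H] by (simp add: q_def)
qed


section \<open>Borel regularity of Hausdorff measure\<close>

lemma hausdorff_pre_antimono:
  assumes "\<delta> \<le> \<delta>'"
  shows "hausdorff_pre k \<delta>' A \<le> hausdorff_pre k \<delta> A"
  unfolding hausdorff_pre_def using assms by (intro INF_superset_mono) (auto intro: order_trans)

lemma hausdorff_pre_le_outer: "\<delta> > 0 \<Longrightarrow> hausdorff_pre k \<delta> A \<le> hausdorff_outer k A"
  unfolding hausdorff_outer_def by (rule SUP_upper) auto

lemma hausdorff_outer_mono: "A \<subseteq> B \<Longrightarrow> hausdorff_outer k A \<le> hausdorff_outer k B"
  using outer_measure_space_hausdorff[of k]
  by (auto simp: outer_measure_space_def increasing_def)

lemma hausdorff_outer_empty [simp]: "hausdorff_outer k {} = 0"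
  using outer_measure_space_hausdorff[of k]
  by (auto simp: outer_measure_space_def positive_def)

lemma hausdorff_outer_UN_le: "hausdorff_outer k (\<Union>i. A i) \<le> (\<Sum>i. hausdorff_outer k (A i))"
  unfolding hausdorff_outer_def[of k "\<Union>i. A i"]
proof (rule SUP_least)
  fix \<delta> :: real assume "\<delta> \<in> {0<..}"
  then have "(\<Sum>i. hausdorff_pre k \<delta> (A i)) \<le> (\<Sum>i. hausdorff_outer k (A i))"
    by (intro suminf_le hausdorff_pre_le_outer) auto
  with hausdorff_pre_countably_subadditive
  show "hausdorff_pre k \<delta> (\<Union>i. A i) \<le> (\<Sum>i. hausdorff_outer k (A i))"
    by (rule order_trans)
qed

lemma hausdorff_outer_Un_le:
  "hausdorff_outer k (A \<union> B) \<le> hausdorff_outer k A + hausdorff_outer k B"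
proof -
  have "hausdorff_outer k (\<Union>i. binaryset A B i) \<le> (\<Sum>i. hausdorff_outer k (binaryset A B i))"
    by (rule hausdorff_outer_UN_le)
  then show ?thesis
    by (simp add: UN_binaryset_eq suminf_binaryset_eq)
qed

text \<open>A covering set of diameter less than \<open>d\<close> cannot meet both \<open>A\<close> and \<open>B\<close>.\<close>

lemma hausdorff_outer_separated:
  assumes "d > 0" and sep: "\<And>x y. x \<in> A \<Longrightarrow> y \<in> B \<Longrightarrow> d \<le> dist x y"
  shows "hausdorff_outer k A + hausdorff_outer k B \<le> hausdorff_outer k (A \<union> B)"
proof -
  have pre: "hausdorff_pre k \<delta> A + hausdorff_pre k \<delta> B \<le> hausdorff_pre k \<delta> (A \<union> B)"
    if "\<delta> < d" "\<delta> > 0" for \<delta>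
    unfolding hausdorff_pre_def[of k \<delta> "A \<union> B"]
  proof (rule INF_greatest, clarify)
    fix C :: "nat \<Rightarrow> 'a set"
    assume C: "A \<union> B \<subseteq> (\<Union>i. C i)" "\<forall>i. bounded (C i) \<and> diameter (C i) \<le> \<delta>"
    define D where "D S i = (if C i \<inter> S = {} then {} else C i)" for S i
    have D: "hausdorff_pre k \<delta> S \<le> (\<Sum>i. hausdorff_cost k (D S i))" if "S \<subseteq> (\<Union>i. C i)" for S
      unfolding hausdorff_pre_def using that C(2) \<open>\<delta> > 0\<close>
      by (intro INF_lower) (fastforce simp: D_def)
    have "C i \<inter> A = {} \<or> C i \<inter> B = {}" for i
      using C(2) \<open>\<delta> < d\<close> sep diameter_bounded_bound[of "C i"] by fastforce
    then have le: "hausdorff_cost k (D A i) + hausdorff_cost k (D B i) \<le> hausdorff_cost k (C i)" for i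
      by (auto simp: D_def hausdorff_cost_def)
    have "hausdorff_pre k \<delta> A + hausdorff_pre k \<delta> B
        \<le> (\<Sum>i. hausdorff_cost k (D A i)) + (\<Sum>i. hausdorff_cost k (D B i))"
      using C(1) by (intro add_mono D) auto
    also have "\<dots> = (\<Sum>i. hausdorff_cost k (D A i) + hausdorff_cost k (D B i))"
      by (rule suminf_add) auto
    also have "\<dots> \<le> (\<Sum>i. hausdorff_cost k (C i))"
      using le by (intro suminf_le) auto
    finally show "hausdorff_pre k \<delta> A + hausdorff_pre k \<delta> B \<le> (\<Sum>i. hausdorff_cost k (C i))" .
  qed
  have "hausdorff_outer k A + hausdorff_outer k B
      = (SUP \<delta>\<in>{0<..}. hausdorff_pre k \<delta> A + hausdorff_pre k \<delta> B)"
    unfolding hausdorff_outer_def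
  proof (rule SUP_add_directed_ennreal[symmetric])
    fix i j :: real assume "i \<in> {0<..}" "j \<in> {0<..}"
    then show "\<exists>l\<in>{0<..}. hausdorff_pre k i A + hausdorff_pre k j B
        \<le> hausdorff_pre k l A + hausdorff_pre k l B"
      by (intro bexI[of _ "min i j"] add_mono hausdorff_pre_antimono) auto
  qed
  also have "\<dots> \<le> hausdorff_outer k (A \<union> B)"
  proof (rule SUP_least)
    fix \<delta> :: real assume "\<delta> \<in> {0<..}"
    define \<epsilon> where "\<epsilon> = min \<delta> (d / 2)"
    have \<epsilon>: "\<epsilon> \<le> \<delta>" "\<epsilon> < d" "\<epsilon> > 0"
      using \<open>\<delta> \<in> {0<..}\<close> \<open>d > 0\<close> by (auto simp: \<epsilon>_def)
    have "hausdorff_pre k \<delta> A + hausdorff_pre k \<delta> B \<le> hausdorff_pre k \<epsilon> A + hausdorff_pre k \<epsilon> B"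
      using \<epsilon>(1) by (intro add_mono hausdorff_pre_antimono)
    also have "\<dots> \<le> hausdorff_outer k (A \<union> B)"
      using pre[OF \<epsilon>(2,3)] hausdorff_pre_le_outer[OF \<epsilon>(3), of k "A \<union> B"] by (rule order_trans)
    finally show "hausdorff_pre k \<delta> A + hausdorff_pre k \<delta> B \<le> hausdorff_outer k (A \<union> B)" .
  qed
  finally show ?thesis .
qed

lemma ex_suminf_tail_le:
  fixes f :: "nat \<Rightarrow> ennreal"
  assumes "(\<Sum>i. f i) < top" "e > 0"
  shows "\<exists>k. (\<Sum>i. f (i + k)) \<le> ennreal e"
proof (rule ccontr)
  assume "\<not> ?thesis"
  then have tail: "(\<Sum>i. f (i + k)) > ennreal e" for k
    by (simp add: not_le)
  have "(\<Sum>i<k. f i) + ennreal e \<le> (\<Sum>i. f i)" for k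
    using suminf_offset[of f k] tail[of k] summableI by (metis add.commute add_left_mono less_imp_le)
  then have "(SUP k. (\<Sum>i<k. f i) + ennreal e) \<le> (\<Sum>i. f i)"
    by (rule SUP_least)
  then have "(\<Sum>i. f i) + ennreal e \<le> (\<Sum>i. f i)"
    by (simp add: ennreal_SUP_add_left suminf_eq_SUP)
  then show False
    using assms ennreal_add_left_cancel_le[of "\<Sum>i. f i" "ennreal e" 0] by auto
qed

text \<open>
  Caratheodory's criterion: the layers \<open>R j\<close> of points of \<open>A\<close> at distance about \<open>1/j\<close> from \<open>F\<close> are
  separated for indices of equal parity, so their outer measures are summable.
\<close>

lemma closed_in_sets_hausdorff:
  fixes F :: "'a::metric_space set"
  assumes "closed F"
  shows "F \<in> sets (hausdorff_measure k)"
proof (cases "F = {}")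
  case False
  let ?\<mu> = "hausdorff_outer k :: 'a set \<Rightarrow> ennreal"
  have "?\<mu> (F \<inter> A) + ?\<mu> (A - F) = ?\<mu> A" for A
  proof (rule antisym)
    show "?\<mu> A \<le> ?\<mu> (F \<inter> A) + ?\<mu> (A - F)"
      using hausdorff_outer_Un_le[of k "F \<inter> A" "A - F"] by (simp add: Int_Diff_Un Int_commute)
    show "?\<mu> (F \<inter> A) + ?\<mu> (A - F) \<le> ?\<mu> A"
    proof (cases "?\<mu> A = top")
      case fin: False
      define E where "E j = {x\<in>A. 1 / real (j + 1) \<le> infdist x F}" for j
      define R where "R j = E (Suc j) - E j" for j
      have parity: "(\<Sum>j<N. ?\<mu> (R (2 * j + p))) \<le> ?\<mu> (\<Union>j<N. R (2 * j + p))" for N p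
      proof (induction N)
        case (Suc N)
        define d where "d = 1 / real (2 * N + p) - 1 / real (2 * N + p + 1)"
        show ?case
        proof (cases "N = 0")
          case N: False
          have "d \<le> dist x y" if x: "x \<in> (\<Union>j<N. R (2 * j + p))" and y: "y \<in> R (2 * N + p)" for x y
          proof -
            obtain j where j: "j < N" "x \<in> R (2 * j + p)"
              using x by auto
            have "1 / real (2 * N + p) \<le> 1 / real (Suc (2 * j + p) + 1)"
              using j(1) N by (intro divide_left_mono) auto
            also have "\<dots> \<le> infdist x F"
              using j(2) by (simp add: R_def E_def)
            finally have "1 / real (2 * N + p) \<le> infdist x F" .
            moreover have "infdist y F < 1 / real (2 * N + p + 1)"
              using y by (auto simp: R_def E_def)
            ultimately show ?thesis
              using infdist_triangle[of x F y] by (simp add: d_def)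
          qed
          moreover have "d > 0"
            using N by (simp add: d_def frac_less2)
          ultimately have "?\<mu> (\<Union>j<N. R (2 * j + p)) + ?\<mu> (R (2 * N + p))
              \<le> ?\<mu> ((\<Union>j<N. R (2 * j + p)) \<union> R (2 * N + p))"
            by (rule hausdorff_outer_separated[rotated])
          moreover have "(\<Union>j<Suc N. R (2 * j + p)) = (\<Union>j<N. R (2 * j + p)) \<union> R (2 * N + p)"
            by (auto simp: less_Suc_eq)
          ultimately show ?thesis
            using order_trans[OF add_right_mono[OF Suc]] by (simp del: UN_simps add_right_mono)
        qed (auto simp: lessThan_Suc)
      qed simp
      have RA: "R j \<subseteq> A" for j
        by (auto simp: R_def E_def)
      have "(\<Sum>j. ?\<mu> (R (2 * j + p))) \<le> ?\<mu> A" for p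
        unfolding suminf_eq_SUP
        using RA by (intro SUP_least order_trans[OF parity] hausdorff_outer_mono) auto
      then have half: "(\<Sum>j. ?\<mu> (R (2 * j + p))) < top" for p
        using fin by (metis less_top order_le_less_trans)
      have "(\<Sum>j. ?\<mu> (R j)) = (\<Sum>j. ?\<mu> (R (2 * j)) + ?\<mu> (R (2 * j + 1)))"
      proof -
        have "(\<Sum>j. ?\<mu> (R j)) = (\<Sum>i. \<Sum>j\<in>{i * 2..<i * 2 + 2}. ?\<mu> (R j))"
          using sums_group[OF summable_sums[OF summableI[of "\<lambda>j. ?\<mu> (R j)"]], of 2]
          by (simp add: sums_iff)
        also have "\<dots> = (\<Sum>j. ?\<mu> (R (2 * j)) + ?\<mu> (R (2 * j + 1)))"
          by (intro suminf_cong) (simp add: numeral_2_eq_2 mult.commute)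
        finally show ?thesis .
      qed
      also have "\<dots> = (\<Sum>j. ?\<mu> (R (2 * j))) + (\<Sum>j. ?\<mu> (R (2 * j + 1)))"
        by (rule suminf_add[symmetric]) auto
      also have "\<dots> < top"
        using half[of 0] half[of 1] by simp
      finally have R_fin: "(\<Sum>j. ?\<mu> (R j)) < top" .
      have diff: "A - F \<subseteq> E l \<union> (\<Union>j. R (j + l))" for l
      proof
        fix x assume x: "x \<in> A - F"
        then have "infdist x F > 0"
          using infdist_pos_not_in_closed[OF assms False, of x] by auto
        then obtain j where "1 / real (j + 1) < infdist x F"
          using reals_Archimedean[of "infdist x F"] by (auto simp: divide_inverse)
        then have "\<exists>j. x \<in> E j"
          using x by (auto simp: E_def intro: less_imp_le)
        define i where "i = (LEAST j. x \<in> E j)"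
        have i: "x \<in> E i" "\<And>j. j < i \<Longrightarrow> x \<notin> E j"
          using LeastI_ex[OF \<open>\<exists>j. x \<in> E j\<close>] not_less_Least by (auto simp: i_def)
        show "x \<in> E l \<union> (\<Union>j. R (j + l))"
        proof (cases "i \<le> l")
          case True
          have "1 / real (l + 1) \<le> 1 / real (i + 1)"
            using True by (intro divide_left_mono) auto
          then show ?thesis
            using i(1) by (auto simp: E_def)
        next
          case False
          then have "x \<in> R (i - 1 - l + l)"
            using i(1) i(2)[of "i - 1"] by (simp add: R_def)
          then show ?thesis
            by blast
        qed
      qed
      show ?thesis
      proof (rule ennreal_le_epsilon)
        fix e :: real assume "e > 0"
        then obtain l where l: "(\<Sum>j. ?\<mu> (R (j + l))) \<le> ennreal e"
          using ex_suminf_tail_le[OF R_fin] by blast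
        have "?\<mu> (A - F) \<le> ?\<mu> (E l) + (\<Sum>j. ?\<mu> (R (j + l)))"
          by (rule order_trans[OF order_trans[OF hausdorff_outer_mono[OF diff] hausdorff_outer_Un_le]
                add_left_mono[OF hausdorff_outer_UN_le]])
        then have "?\<mu> (F \<inter> A) + ?\<mu> (A - F) \<le> ?\<mu> (F \<inter> A) + (?\<mu> (E l) + ennreal e)"
          by (rule add_left_mono[OF order_trans[OF _ add_left_mono[OF l]]])
        also have "\<dots> = ?\<mu> (F \<inter> A) + ?\<mu> (E l) + ennreal e"
          by (simp add: add.assoc)
        also have "?\<mu> (F \<inter> A) + ?\<mu> (E l) \<le> ?\<mu> (F \<inter> A \<union> E l)"
        proof (rule hausdorff_outer_separated)
          show "1 / real (l + 1) \<le> dist x y" if "x \<in> F \<inter> A" "y \<in> E l" for x y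
            using that infdist_le[of x F y] by (auto simp: E_def dist_commute)
        qed simp
        also have "\<dots> \<le> ?\<mu> A"
          by (rule hausdorff_outer_mono) (auto simp: E_def)
        finally show "?\<mu> (F \<inter> A) + ?\<mu> (A - F) \<le> ?\<mu> A + ennreal e"
          by (simp add: add_right_mono)
      qed
    qed simp
  qed
  then show ?thesis
    by (auto simp: sets_hausdorff_measure lambda_system_def Diff_eq Int_commute)
qed simp

lemma space_hausdorff_measure [simp]: "space (hausdorff_measure k) = UNIV"
  unfolding hausdorff_measure_def by (rule space_measure_of) simp

lemma borel_subset_sets_hausdorff: "sets borel \<subseteq> sets (hausdorff_measure k)"
proof -
  have "sigma_sets UNIV (Collect closed) \<subseteq> sets (hausdorff_measure k)"
    using sets.sigma_sets_subset[of "Collect closed" "hausdorff_measure k"] closed_in_sets_hausdorff[of _ k]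
    by auto
  then show ?thesis
    by (simp add: borel_eq_closed)
qed

lemma hausdorff_Borel_hull:
  obtains B where "B \<in> sets borel" "A \<subseteq> B" "hausdorff_outer k B = hausdorff_outer k A"
proof (cases "hausdorff_outer k A = top")
  case True
  then show ?thesis
    using that[of UNIV] hausdorff_outer_mono[of A UNIV k] by (auto simp: top_unique)
next
  case fin: False
  define r where "r j = 1 / real (Suc j)" for j
  have r: "r j > 0" for j
    by (simp add: r_def)
  have "\<exists>C. A \<subseteq> (\<Union>i. C i) \<and> (\<forall>i. bounded (C i) \<and> diameter (C i) \<le> r j)
          \<and> (\<Sum>i. hausdorff_cost k (C i)) < hausdorff_outer k A + ennreal (r j)" for j
  proof -
    have "hausdorff_outer k A < hausdorff_outer k A + ennreal (r j)"
      using r[of j] fin ennreal_add_left_cancel_less[of "hausdorff_outer k A" 0 "ennreal (r j)"]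
      by (auto simp: less_top)
    with hausdorff_pre_le_outer[OF r] have "hausdorff_pre k (r j) A < hausdorff_outer k A + ennreal (r j)"
      by (rule order_le_less_trans)
    then show ?thesis
      unfolding hausdorff_pre_def INF_less_iff by auto
  qed
  then obtain C where C: "\<And>j. A \<subseteq> (\<Union>i. C j i)" "\<And>j i. bounded (C j i)"
      "\<And>j i. diameter (C j i) \<le> r j"
      "\<And>j. (\<Sum>i. hausdorff_cost k (C j i)) < hausdorff_outer k A + ennreal (r j)"
    by metis
  define B where "B = (\<Inter>j. \<Union>i. closure (C j i))"
  have "A \<subseteq> (\<Union>i. closure (C j i))" for j
    using C(1)[of j] by (rule order_trans) (intro UN_mono order_refl closure_subset)
  then have "A \<subseteq> B"
    unfolding B_def by (rule INT_greatest)
  have "hausdorff_pre k \<delta> B \<le> hausdorff_outer k A" if "\<delta> > 0" for \<delta>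
  proof (rule ennreal_le_epsilon)
    fix e :: real assume "e > 0"
    obtain j where "inverse (real (Suc j)) < min e \<delta>"
      using reals_Archimedean[of "min e \<delta>"] \<open>e > 0\<close> \<open>\<delta> > 0\<close> by auto
    then have j: "r j \<le> e" "r j \<le> \<delta>"
      by (auto simp: r_def divide_inverse)
    have "hausdorff_pre k \<delta> B \<le> (\<Sum>i. hausdorff_cost k (closure (C j i)))"
      unfolding hausdorff_pre_def
    proof (rule INF_lower, intro CollectI conjI allI)
      show "B \<subseteq> (\<Union>i. closure (C j i))"
        by (auto simp: B_def)
      show "diameter (closure (C j i)) \<le> \<delta>" for i
        using C(3)[of j i] j(2) diameter_closure[OF C(2)] by (metis order_trans)
    qed (simp add: C(2) bounded_closure)
    also have "\<dots> = (\<Sum>i. hausdorff_cost k (C j i))"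
      by (intro suminf_cong) (auto simp: hausdorff_cost_def diameter_closure[OF C(2)])
    also have "\<dots> \<le> hausdorff_outer k A + ennreal e"
      using C(4)[of j] j(1) by (meson add_left_mono ennreal_leI less_imp_le order_trans)
    finally show "hausdorff_pre k \<delta> B \<le> hausdorff_outer k A + ennreal e" .
  qed
  then have "hausdorff_outer k B \<le> hausdorff_outer k A"
    unfolding hausdorff_outer_def[of k B] by (intro SUP_least) auto
  then show ?thesis
    using that[of B] \<open>A \<subseteq> B\<close> hausdorff_outer_mono[OF \<open>A \<subseteq> B\<close>, of k] by (auto simp: B_def intro: antisym)
qed

lemma null_sets_hausdorff_iff: "N \<in> null_sets (hausdorff_measure k) \<longleftrightarrow> hausdorff_outer k N = 0"
proof
  assume N: "hausdorff_outer k N = 0"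
  have "hausdorff_outer k (N \<inter> A) + hausdorff_outer k (A - N) = hausdorff_outer k A" for A
  proof (rule antisym)
    show "hausdorff_outer k (N \<inter> A) + hausdorff_outer k (A - N) \<le> hausdorff_outer k A"
      using hausdorff_outer_mono[of "N \<inter> A" N k] hausdorff_outer_mono[of "A - N" A k] N by auto
    show "hausdorff_outer k A \<le> hausdorff_outer k (N \<inter> A) + hausdorff_outer k (A - N)"
      using hausdorff_outer_Un_le[of k "N \<inter> A" "A - N"] by (simp add: Int_Diff_Un Int_commute)
  qed
  then have "N \<in> sets (hausdorff_measure k)"
    by (auto simp: sets_hausdorff_measure lambda_system_def Diff_eq Int_commute)
  then show "N \<in> null_sets (hausdorff_measure k)"
    using N by (auto simp: emeasure_hausdorff_measure)
qed (metis emeasure_hausdorff_measure null_setsD1 null_setsD2)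

lemma hausdorff_Borel_kernel_finite:
  assumes A: "A \<in> sets (hausdorff_measure k)" and fin: "hausdorff_outer k A < top"
  obtains C where "C \<in> sets borel" "C \<subseteq> A" "hausdorff_outer k (A - C) = 0"
proof -
  let ?H = "hausdorff_measure k"
  obtain B where B: "B \<in> sets borel" "A \<subseteq> B" "hausdorff_outer k B = hausdorff_outer k A"
    by (rule hausdorff_Borel_hull)
  have "B \<in> sets ?H"
    using B(1) borel_subset_sets_hausdorff by blast
  then have "emeasure ?H (B - A) = emeasure ?H B - emeasure ?H A"
    using A B fin by (intro emeasure_Diff) (auto simp: emeasure_hausdorff_measure)
  also have "\<dots> = 0"
    using A B fin \<open>B \<in> sets ?H\<close> by (simp add: emeasure_hausdorff_measure less_top)
  finally have "hausdorff_outer k (B - A) = 0"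
    using A \<open>B \<in> sets ?H\<close> by (simp add: emeasure_hausdorff_measure)
  then obtain B' where B': "B' \<in> sets borel" "B - A \<subseteq> B'" "hausdorff_outer k B' = 0"
    using hausdorff_Borel_hull[of "B - A" k] by auto
  show ?thesis
  proof (rule that[of "B - B'"])
    have "A - (B - B') \<subseteq> B'"
      using B(2) by blast
    then show "hausdorff_outer k (A - (B - B')) = 0"
      using hausdorff_outer_mono[of _ B' k] B'(3) by (metis le_zero_eq)
  qed (use B B' in auto)
qed

text \<open>The weight of a tangent field makes \<open>M\<close> \<open>\<sigma>\<close>-finite.\<close>

lemma tangent_field_Borel_kernel:
  assumes M: "M \<in> sets (hausdorff_measure k)" and T: "tangent_field k M T"
  obtains C where "C \<in> sets borel" "C \<subseteq> M" "hausdorff_outer k (M - C) = 0"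
proof -
  let ?H = "hausdorff_measure k :: 'a measure"
  obtain w :: "'a \<Rightarrow> real" where w [measurable]: "w \<in> borel_measurable ?H"
    and pos: "\<And>x. x \<in> M \<Longrightarrow> w x > 0"
    and fin: "\<And>K. compact K \<Longrightarrow> (\<integral>\<^sup>+x\<in>K \<inter> M. ennreal (w x) \<partial>?H) < \<infinity>"
    using T unfolding tangent_field_def by blast
  define A where "A i = cball 0 (real i) \<inter> M \<inter> {x\<in>space ?H. 1 / real (Suc i) \<le> w x}" for i
  have [measurable]: "cball 0 (real i) \<in> sets ?H" for i
    using borel_subset_sets_hausdorff[of k] by auto
  note M [measurable]
  have A: "A i \<in> sets ?H" for i
    unfolding A_def by measurable
  have "hausdorff_outer k (A i) < top" for i
  proof -
    have "ennreal (1 / real (Suc i)) * emeasure ?H (A i) = (\<integral>\<^sup>+x. ennreal (1 / real (Suc i)) * indicator (A i) x \<partial>?H)"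
      using A by (simp add: nn_integral_cmult_indicator)
    also have "\<dots> \<le> (\<integral>\<^sup>+x\<in>cball 0 (real i) \<inter> M. ennreal (w x) \<partial>?H)"
      by (intro nn_integral_mono) (auto simp: A_def indicator_def intro!: ennreal_leI)
    also have "\<dots> < \<infinity>"
      by (rule fin) simp
    finally have "emeasure ?H (A i) < top"
      by (auto simp: ennreal_mult_less_top less_top[symmetric] ennreal_mult_eq_top_iff)
    then show ?thesis
      using A by (simp add: emeasure_hausdorff_measure)
  qed
  then have "\<exists>C. C \<in> sets borel \<and> C \<subseteq> A i \<and> hausdorff_outer k (A i - C) = 0" for i
    using hausdorff_Borel_kernel_finite[OF A] by metis
  then obtain C where C: "\<And>i. C i \<in> sets borel" "\<And>i. C i \<subseteq> A i" "\<And>i. hausdorff_outer k (A i - C i) = 0"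
    by metis
  have "M \<subseteq> (\<Union>i. A i)"
  proof
    fix x assume "x \<in> M"
    obtain i where "inverse (real (Suc i)) < w x"
      using reals_Archimedean pos[OF \<open>x \<in> M\<close>] by blast
    moreover obtain j where "norm x \<le> real j"
      using real_arch_simple by blast
    moreover have "inverse (real (Suc (max i j))) \<le> inverse (real (Suc i))"
      by (intro le_imp_inverse_le) auto
    ultimately have "norm x \<le> real (max i j)" "inverse (real (Suc (max i j))) \<le> w x"
      by linarith+
    then have "x \<in> A (max i j)"
      using \<open>x \<in> M\<close> by (auto simp: A_def inverse_eq_divide simp del: of_nat_Suc)
    then show "x \<in> (\<Union>i. A i)"
      by blast
  qed
  then have "M - (\<Union>i. C i) \<subseteq> (\<Union>i. A i - C i)"
    by blast
  then have "hausdorff_outer k (M - (\<Union>i. C i)) \<le> (\<Sum>i. hausdorff_outer k (A i - C i))"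
    by (rule order_trans[OF hausdorff_outer_mono hausdorff_outer_UN_le])
  then show ?thesis
    using C by (intro that[of "\<Union>i. C i"]) (auto simp: A_def)
qed

text \<open>
  The density of \<^const>\<open>area_measure\<close> is not assumed measurable; where it is not, the measure is the zero
  measure, so null sets are preserved in any case.
\<close>

lemma null_sets_area_measure:
  fixes M :: "('a::finite, 'b::finite) mink set"
  assumes Z: "Z \<in> sets (hausdorff_measure k)" and null: "hausdorff_outer k (M \<inter> Z) = 0"
  shows "Z \<in> null_sets (area_measure k M T)"
proof -
  let ?H = "hausdorff_measure k :: ('a, 'b) mink measure"
  have "AE x in ?H. x \<notin> M \<inter> Z"
    using null by (intro AE_not_in) (simp add: null_sets_hausdorff_iff)
  then have "(\<integral>\<^sup>+x\<in>Z. (indicator M x * ennreal (area_factor (T x))) \<partial>?H) = (\<integral>\<^sup>+x. 0 \<partial>?H)"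
    by (intro nn_integral_cong_AE) (auto simp: indicator_def elim!: eventually_mono)
  then show ?thesis
    using Z unfolding area_measure_def density_def
    by (auto simp: null_sets_def emeasure_measure_of_conv sets_measure_of_conv sets.space_closed sets.sigma_sets_eq)
qed

lemma spacelike_representation_AE:
  fixes U M :: "('n::finite, 'm::finite) mink set"
  assumes U: "open U" and sets: "sets \<mu> = sets (restrict_space borel U)"
    and rep: "spacelike_representation U \<mu> M T \<theta>"
    and P: "AE x in hausdorff_measure CARD('n). x \<in> M \<longrightarrow> P x"
  shows "AE x in \<mu>. P x"
proof -
  let ?k = "CARD('n)"
  have M: "M \<in> sets (hausdorff_measure ?k)" "tangent_field ?k M T" "M \<subseteq> U"
    and \<mu>: "\<And>A. A \<in> sets \<mu> \<Longrightarrow> emeasure \<mu> A = (\<integral>\<^sup>+x\<in>A. of_nat (\<theta> x) \<partial>area_measure ?k M T)"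
    using rep by (auto simp: spacelike_representation_def rectifiable_def)
  obtain N where N: "{x. \<not> (x \<in> M \<longrightarrow> P x)} \<subseteq> N" "hausdorff_outer ?k N = 0"
    using AE_E[OF P]
    by (metis (no_types, lifting) UNIV_I Collect_cong emeasure_hausdorff_measure space_hausdorff_measure)
  obtain B where B: "B \<in> sets borel" "N \<subseteq> B" "hausdorff_outer ?k B = 0"
    using hausdorff_Borel_hull[of N ?k] N(2) by metis
  obtain C where C: "C \<in> sets borel" "C \<subseteq> M" "hausdorff_outer ?k (M - C) = 0"
    using tangent_field_Borel_kernel[OF M(1,2)] by blast
  define Z where "Z = U - (C - B)"
  have Zb: "Z \<in> sets borel"
    using U B C by (auto simp: Z_def)
  then have Z: "Z \<in> sets \<mu>"
    using sets U by (auto simp: sets_restrict_space_iff Z_def)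
  have "M \<inter> Z \<subseteq> (M - C) \<union> B"
    by (auto simp: Z_def)
  then have "hausdorff_outer ?k (M \<inter> Z) \<le> hausdorff_outer ?k (M - C) + hausdorff_outer ?k B"
    by (rule order_trans[OF hausdorff_outer_mono hausdorff_outer_Un_le])
  then have "Z \<in> null_sets (area_measure ?k M T)"
    using B C Zb borel_subset_sets_hausdorff by (intro null_sets_area_measure) auto
  then have "AE x in area_measure ?k M T. x \<notin> Z"
    by (rule AE_not_in)
  then have "(\<integral>\<^sup>+x\<in>Z. of_nat (\<theta> x) \<partial>area_measure ?k M T) = (\<integral>\<^sup>+x. 0 \<partial>area_measure ?k M T)"
    by (intro nn_integral_cong_AE) auto
  then have "Z \<in> null_sets \<mu>"
    using \<mu>[OF Z] Z by auto
  moreover have "space \<mu> = U"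
    using sets_eq_imp_space_eq[OF sets] by (simp add: space_restrict_space)
  ultimately show ?thesis
    using N B C by (intro AE_I'[of Z]) (auto simp: Z_def)
qed


section \<open>Nonnegative functions of class \<open>C\<^sup>2\<close>\<close>

lemma Ck_on_fst:
  fixes f :: "'a::real_normed_vector \<Rightarrow> 'b::real_normed_vector"
  assumes "Ck_on k f UNIV"
  shows "Ck_on k (\<lambda>p::'a \<times> 'c::real_normed_vector. f (fst p)) UNIV"
  using assms
proof (induction k arbitrary: f)
  case 0
  then show ?case
    by (auto intro!: continuous_intros continuous_on_compose2[of UNIV f])
next
  case (Suc k)
  have D: "((\<lambda>p. f (fst p)) has_derivative (\<lambda>v. frechet_derivative f (at (fst p)) (fst v))) (at p)"
    for p :: "'a \<times> 'c"
    using Suc.prems by (intro has_derivative_compose[of fst fst, where g = f])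
      (auto intro!: derivative_eq_intros simp: frechet_derivative_works)
  have "frechet_derivative (\<lambda>p. f (fst p)) (at p) = (\<lambda>v. frechet_derivative f (at (fst p)) (fst v))"
    for p :: "'a \<times> 'c"
    using frechet_derivative_at[OF D] by simp
  then show ?case
    using Suc.prems Suc.IH[of "\<lambda>x. frechet_derivative f (at x) v" for v] differentiableI[OF D]
    by simp
qed

lemma linear_functional_expand:
  fixes l :: "'a::euclidean_space \<Rightarrow> real"
  assumes "linear l"
  shows "l u = (\<Sum>i\<in>Basis. (u \<bullet> i) * l i)"
proof -
  have "l u = l (\<Sum>i\<in>Basis. (u \<bullet> i) *\<^sub>R i)"
    by (simp add: euclidean_representation)
  then show ?thesis
    by (simp only: linear_sum[OF assms] linear_scale[OF assms] real_scaleR_def)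
qed

context
  fixes f :: "'a::euclidean_space \<Rightarrow> real"
  assumes f: "Ck_on 2 f UNIV"
begin

lemma C2_has_derivative: "(f has_derivative frechet_derivative f (at x)) (at x)"
  and C2_has_derivative2: "((\<lambda>y. frechet_derivative f (at y) v) has_derivative
    frechet_derivative (\<lambda>y. frechet_derivative f (at y) v) (at x)) (at x)"
  and C2_continuous: "continuous_on UNIV (\<lambda>y. frechet_derivative (\<lambda>y. frechet_derivative f (at y) v) (at y) w)"
  using f by (auto simp: numeral_2_eq_2 frechet_derivative_works[symmetric])

lemma C2_hessian_expand:
  "frechet_derivative (\<lambda>y. frechet_derivative f (at y) v) (at x) w =
    (\<Sum>i\<in>Basis. \<Sum>j\<in>Basis. (v \<bullet> i) * (w \<bullet> j) * frechet_derivative (\<lambda>y. frechet_derivative f (at y) i) (at x) j)"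
proof -
  let ?D = "\<lambda>y. frechet_derivative f (at y)"
  let ?H = "\<lambda>i. frechet_derivative (\<lambda>y. ?D y i) (at x)"
  have "?D y v = (\<Sum>i\<in>Basis. (v \<bullet> i) * ?D y i)" for y
    by (rule linear_functional_expand) (rule has_derivative_linear[OF C2_has_derivative])
  then have "((\<lambda>y. ?D y v) has_derivative (\<lambda>w. \<Sum>i\<in>Basis. (v \<bullet> i) * ?H i w)) (at x)"
    by (simp only:) (intro has_derivative_sum has_derivative_mult_right C2_has_derivative2)
  from fun_cong[OF frechet_derivative_at[OF this], of w]
  have "?H v w = (\<Sum>i\<in>Basis. (v \<bullet> i) * ?H i w)"
    by (rule sym)
  also have "\<dots> = (\<Sum>i\<in>Basis. (v \<bullet> i) * (\<Sum>j\<in>Basis. (w \<bullet> j) * ?H i j))"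
    by (intro sum.cong refl arg_cong2[where f = "(*)"]
        linear_functional_expand has_derivative_linear[OF C2_has_derivative2])
  finally show ?thesis
    by (simp add: sum_distrib_left mult.assoc)
qed

lemma C2_hessian_le:
  "\<bar>frechet_derivative (\<lambda>y. frechet_derivative f (at y) v) (at x) v\<bar> \<le> (norm v)\<^sup>2 * hessian_norm f x"
proof -
  let ?H = "\<lambda>i j. frechet_derivative (\<lambda>y. frechet_derivative f (at y) i) (at x) j"
  let ?B = "Basis \<times> Basis :: ('a \<times> 'a) set"
  have "?H v v = (\<Sum>(i, j)\<in>?B. (v \<bullet> i) * (v \<bullet> j) * ?H i j)"
    by (subst C2_hessian_expand) (simp add: sum.cartesian_product)
  then have "(?H v v)\<^sup>2 \<le> (\<Sum>(i, j)\<in>?B. ((v \<bullet> i) * (v \<bullet> j))\<^sup>2) * (\<Sum>(i, j)\<in>?B. (?H i j)\<^sup>2)"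
    using Cauchy_Schwarz_ineq_sum[of "\<lambda>(i, j). (v \<bullet> i) * (v \<bullet> j)" "\<lambda>(i, j). ?H i j" ?B]
    by (simp add: case_prod_unfold)
  also have "(\<Sum>(i, j)\<in>?B. ((v \<bullet> i) * (v \<bullet> j))\<^sup>2) = ((norm v)\<^sup>2)\<^sup>2"
    unfolding power2_norm_eq_inner euclidean_inner[of v v]
    by (simp add: power2_eq_square sum_product sum.cartesian_product[symmetric] mult_ac)
  also have "(\<Sum>(i, j)\<in>?B. (?H i j)\<^sup>2) = (hessian_norm f x)\<^sup>2"
    by (simp add: hessian_norm_def sum_nonneg sum.cartesian_product[symmetric])
  finally have "\<bar>?H v v\<bar>\<^sup>2 \<le> ((norm v)\<^sup>2 * hessian_norm f x)\<^sup>2"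
    by (simp add: power_mult_distrib)
  then show ?thesis
    by (rule power2_le_imp_le) (simp add: hessian_norm_def sum_nonneg)
qed

lemma continuous_hessian_norm: "continuous_on UNIV (hessian_norm f)"
  unfolding hessian_norm_def by (intro continuous_intros C2_continuous)

lemma hessian_norm_eq_0:
  assumes "x \<notin> spt f"
  shows "hessian_norm f x = 0"
proof -
  let ?O = "- spt f"
  have O: "open ?O"
    by (simp add: spt_def open_Compl)
  have zero: "f y = 0" if "y \<in> ?O" for y
    using that closure_subset[of "{x. f x \<noteq> 0}"] by (auto simp: spt_def)
  have "frechet_derivative f (at y) = (\<lambda>v. 0)" if "y \<in> ?O" for y
    using zero
    by (intro frechet_derivative_at[symmetric] has_derivative_transform_within_open[OF has_derivative_const[of 0] O that])
      simp
  then have "((\<lambda>y. frechet_derivative f (at y) i) has_derivative (\<lambda>v. 0)) (at x)" for i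
    using assms by (intro has_derivative_transform_within_open[OF has_derivative_const[of 0] O]) auto
  then have "frechet_derivative (\<lambda>y. frechet_derivative f (at y) i) (at x) = (\<lambda>v. 0)" for i
    by (rule frechet_derivative_at[symmetric])
  then show ?thesis
    by (simp add: hessian_norm_def)
qed

lemma bdd_above_hessian_norm:
  assumes "compact (spt f)"
  shows "bdd_above (range (hessian_norm f))"
proof -
  have "compact (hessian_norm f ` spt f)"
    using assms continuous_hessian_norm by (intro compact_continuous_image) (auto intro: continuous_on_subset)
  then have "bdd_above (insert 0 (hessian_norm f ` spt f))"
    by (simp add: bounded_imp_bdd_above compact_imp_bounded)
  then show ?thesis
    by (rule bdd_above_mono) (use hessian_norm_eq_0 in blast)
qed

text \<open>Minimise the Taylor bound of \<open>f \<ge> 0\<close> along the ray in direction \<open>- g\<close>.\<close>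

lemma norm_gradient_le:
  assumes nonneg: "\<And>y. f y \<ge> 0" and S: "\<And>y. hessian_norm f y \<le> S"
    and g: "\<And>v. frechet_derivative f (at x) v = g \<bullet> v"
  shows "(norm g)\<^sup>2 \<le> 2 * f x * S"
proof -
  have "S \<ge> 0"
    using order_trans[OF _ S[of x]] by (simp add: hessian_norm_def sum_nonneg)
  have taylor: "0 \<le> f x - s * (norm g)\<^sup>2 + s\<^sup>2 / 2 * (norm g)\<^sup>2 * S" if "s > 0" for s
  proof -
    let ?D = "\<lambda>y. frechet_derivative f (at y)"
    define w where "w = - g"
    let ?H = "\<lambda>y. frechet_derivative (\<lambda>y. ?D y w) (at y) w"
    let ?p = "\<lambda>t. x + t *\<^sub>R w"
    define diff where "diff m t = (if m = 0 then f (?p t) else if m = 1 then ?D (?p t) w else ?H (?p t))"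
      for m :: nat and t
    have p: "(?p has_derivative (\<lambda>s. s *\<^sub>R w)) (at t)" for t
      by (auto intro!: derivative_eq_intros)
    have real_deriv: "((\<lambda>t. h (?p t)) has_real_derivative l w) (at t)"
      if "(h has_derivative l) (at (?p t))" for h l t
    proof -
      have "(\<lambda>s. l (s *\<^sub>R w)) = (*) (l w)"
        using linear_scale[OF has_derivative_linear[OF that]] by (auto simp: mult.commute)
      then show ?thesis
        using has_derivative_compose[OF p that] by (simp add: has_field_derivative_def)
    qed
    have "\<exists>t. 0 < t \<and> t \<le> s \<and>
        f (?p s) = (\<Sum>m<2. diff m 0 / fact m * s ^ m) + diff 2 t / fact 2 * s ^ 2"
    proof (rule Maclaurin2[OF \<open>s > 0\<close>])
      show "\<forall>m t. m < 2 \<and> 0 \<le> t \<and> t \<le> s \<longrightarrow> (diff m has_real_derivative diff (Suc m) t) (at t)"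
        using real_deriv[OF C2_has_derivative] real_deriv[OF C2_has_derivative2]
        by (auto simp: less_2_cases_iff diff_def[abs_def])
    qed (simp add: diff_def)
    then obtain t where "f (?p s) = f x + ?D x w * s + ?H (?p t) / 2 * s\<^sup>2"
      by (auto simp: diff_def numeral_2_eq_2)
    moreover have "?H (?p t) \<le> (norm g)\<^sup>2 * S"
      using C2_hessian_le[of w "?p t"] mult_left_mono[OF S[of "?p t"], of "(norm g)\<^sup>2"] by (simp add: w_def)
    then have "?H (?p t) / 2 * s\<^sup>2 \<le> (norm g)\<^sup>2 * S / 2 * s\<^sup>2"
      by (intro mult_right_mono divide_right_mono) auto
    ultimately have "f (?p s) \<le> f x + ?D x w * s + (norm g)\<^sup>2 * S / 2 * s\<^sup>2"
      by linarith
    then show ?thesis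
      using nonneg[of "?p s"] by (simp add: g w_def power2_norm_eq_inner mult_ac)
  qed
  show ?thesis
  proof (cases "S = 0")
    case True
    have "norm g = 0"
    proof (rule ccontr)
      assume "norm g \<noteq> 0"
      then have "(norm g)\<^sup>2 > 0"
        by simp
      then show False
        using taylor[of "(f x + 1) / (norm g)\<^sup>2"] True nonneg[of x] by simp
    qed
    then show ?thesis
      using True by simp
  next
    case False
    then show ?thesis
      using taylor[of "1 / S"] \<open>S \<ge> 0\<close> by (simp add: power2_eq_square field_simps)
  qed
qed

end

lemma lip_gradient:
  fixes f :: "('n::finite, 'm::finite) mink \<Rightarrow> real"
  assumes "f differentiable (at x)"
  shows "frechet_derivative f (at x) v = reflect (lip_gradient f x) \<bullet> v"
proof -
  define g where "g = (\<Sum>i\<in>Basis. frechet_derivative f (at x) i *\<^sub>R i)"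
  have "linear (frechet_derivative f (at x))"
    using assms by (rule linear_frechet_derivative)
  then have g: "frechet_derivative f (at x) v = g \<bullet> v" for v
    using linear_functional_expand[of "frechet_derivative f (at x)" v]
    by (simp add: g_def inner_sum_left inner_commute[of v] mult.commute)
  have "lip_gradient f x = reflect g"
    unfolding lip_gradient_def
  proof (rule the_equality)
    show "\<forall>w. lip (reflect g) w = frechet_derivative f (at x) w"
      by (simp add: lip_eq_inner_reflect g)
  next
    fix v assume "\<forall>w. lip v w = frechet_derivative f (at x) w"
    then have "reflect v = g"
      by (simp add: lip_eq_inner_reflect g vector_eq_rdot)
    then show "v = reflect g"
      using reflect_reflect by metis
  qed
  then show ?thesis
    by (simp add: g)
qed


section \<open>The Brakke inequality\<close>

lemma SV_AE_Tan:
  fixes U \<Gamma> :: "('n::finite, 'm::finite) mink set"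
  assumes U: "open U" and \<mu>: "\<mu> \<in> SV U \<Gamma>"
  shows "AE x in \<mu>. spacelike_subspace (Tan U \<mu> x) \<and> dim (Tan U \<mu> x) = CARD('n)"
proof -
  have rect: "spacelike_integer_rectifiable U \<mu>"
    using \<mu> by (simp add: SV_def)
  then have "\<exists>T M \<theta>. spacelike_representation U \<mu> M T \<theta>"
    by (auto simp: spacelike_integer_rectifiable_def)
  then obtain M \<theta> where rep: "spacelike_representation U \<mu> M (Tan U \<mu>) \<theta>"
    using someI_ex[of "\<lambda>T. \<exists>M \<theta>. spacelike_representation U \<mu> M T \<theta>"] by (auto simp: Tan_def)
  then obtain w where "AE x in hausdorff_measure CARD('n). x \<in> M \<longrightarrow> spacelike_subspace (Tan U \<mu> x)"
    and "AE x in hausdorff_measure CARD('n). x \<in> M \<longrightarrow> approx_tangent_plane CARD('n) M w x (Tan U \<mu> x)"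
    unfolding spacelike_representation_def tangent_field_def by blast
  then have "AE x in hausdorff_measure CARD('n).
      x \<in> M \<longrightarrow> spacelike_subspace (Tan U \<mu> x) \<and> dim (Tan U \<mu> x) = CARD('n)"
    by eventually_elim (simp add: approx_tangent_plane_def)
  moreover have "sets \<mu> = sets (restrict_space borel U)"
    using rect by (simp add: spacelike_integer_rectifiable_def radon_measure_def)
  ultimately show ?thesis
    by (intro spacelike_representation_AE[OF U _ rep])
qed

lemma spacetime_test_fst:
  assumes \<phi>: "\<phi> \<in> Ck_compact 2 U" "\<And>x. \<phi> x \<ge> 0"
  shows "(\<lambda>p. \<phi> (fst p)) \<in> spacetime_test U a b"
proof -
  have "{(x, t). t \<in> {a..b} \<and> \<phi> x \<noteq> 0} = {x. \<phi> x \<noteq> 0} \<times> {a..b}"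
    by auto
  then have "closure {(x, t). t \<in> {a..b} \<and> \<phi> x \<noteq> 0} = spt \<phi> \<times> {a..b}"
    by (simp add: closure_Times spt_def)
  then show ?thesis
    using \<phi> Ck_on_fst[of 2 \<phi>] compact_Times[of "spt \<phi>" "{a..b}"]
    unfolding spacetime_test_def Ck_compact_def Let_def by (auto simp del: compact_closure)
qed

lemma brakke_integrand_AE_ge:
  fixes U \<Gamma> :: "('n::finite, 'm::finite) mink set"
  assumes U: "open U" and \<mu>: "\<mu> \<in> SV U \<Gamma>"
    and C2: "Ck_on 2 \<phi> UNIV" and nonneg: "\<And>x. \<phi> x \<ge> 0" and S: "\<And>x. hessian_norm \<phi> x \<le> S"
  shows "AE x in \<mu>. ennreal (- brakke_integrand U \<mu> (\<lambda>p. \<phi> (fst p)) t x)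
    \<le> ennreal S * (ennreal (gradient_function U \<Gamma> \<mu> x) * indicator (spt \<phi>) x)"
proof -
  have "S \<ge> 0"
    using order_trans[OF _ S] by (simp add: hessian_norm_def sum_nonneg)
  have "AE x in \<mu>. mean_curvature U \<mu> x \<in> perp (Tan U \<mu> x)"
    using \<mu> by (simp add: SV_def)
  with SV_AE_Tan[OF U \<mu>] show ?thesis
  proof eventually_elim
    fix x
    assume P: "spacelike_subspace (Tan U \<mu> x) \<and> dim (Tan U \<mu> x) = CARD('n)"
      and H: "mean_curvature U \<mu> x \<in> perp (Tan U \<mu> x)"
    let ?H = "mean_curvature U \<mu> x" and ?u = "lip_gradient \<phi> x"
    have F: "brakke_integrand U \<mu> (\<lambda>p. \<phi> (fst p)) t x = - \<phi> x * lip ?H ?H + lip ?u ?H"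
      by (simp add: brakke_integrand_def Let_def)
    have "(norm (reflect ?u))\<^sup>2 \<le> 2 * \<phi> x * S"
      using lip_gradient differentiableI[OF C2_has_derivative[OF C2]]
      by (intro norm_gradient_le[OF C2 nonneg S]) auto
    then have u: "(norm ?u)\<^sup>2 \<le> 2 * \<phi> x * S"
      by simp
    show "ennreal (- brakke_integrand U \<mu> (\<lambda>p. \<phi> (fst p)) t x)
      \<le> ennreal S * (ennreal (gradient_function U \<Gamma> \<mu> x) * indicator (spt \<phi>) x)"
    proof (cases "\<phi> x = 0")
      case True
      then show ?thesis
        using u by (simp add: F)
    next
      case False
      then have "x \<in> spt \<phi>"
        using closure_subset[of "{x. \<phi> x \<noteq> 0}"] by (auto simp: spt_def)
      moreover have "gradient_function U \<Gamma> \<mu> x = gradient_sq (Tan U \<mu> x)"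
        using P \<mu> by (simp add: gradient_function_def)
      moreover have "- (S * gradient_sq (Tan U \<mu> x)) \<le> - \<phi> x * lip ?H ?H + lip ?u ?H"
        using P H u by (intro lip_perp_ge nonneg \<open>S \<ge> 0\<close>) auto
      ultimately show ?thesis
        using gradient_sq_nonneg[of "Tan U \<mu> x"] P \<open>S \<ge> 0\<close>
        by (simp add: F ennreal_mult[symmetric] ennreal_leI)
    qed
  qed
qed

text \<open>The gradient function is not known to be measurable, so its scaling is moved to the left-hand side.\<close>

lemma integral_ge_of_AE_ge:
  fixes f :: "'a \<Rightarrow> real"
  assumes "S \<ge> 0" and ae: "AE x in M. ennreal (- f x) \<le> ennreal S * v x"
  shows "ennreal (- (\<integral>x. f x \<partial>M)) \<le> ennreal S * (\<integral>\<^sup>+x. v x \<partial>M)"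
proof (cases "integrable M f")
  case int: True
  then have [measurable]: "f \<in> borel_measurable M"
    by simp
  have "- (\<integral>x. f x \<partial>M) \<le> enn2real (\<integral>\<^sup>+x. ennreal (- f x) \<partial>M)"
    by (simp add: real_lebesgue_integral_def[OF int])
  then have "ennreal (- (\<integral>x. f x \<partial>M)) \<le> ennreal (enn2real (\<integral>\<^sup>+x. ennreal (- f x) \<partial>M))"
    by (rule ennreal_leI)
  also have "\<dots> \<le> (\<integral>\<^sup>+x. ennreal (- f x) \<partial>M)"
    by (simp add: ennreal_enn2real_if)
  also have "\<dots> \<le> ennreal S * (\<integral>\<^sup>+x. v x \<partial>M)"
  proof (cases "S = 0")
    case True
    then have "(\<integral>\<^sup>+x. ennreal (- f x) \<partial>M) \<le> (\<integral>\<^sup>+x. 0 \<partial>M)"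
      using ae by (intro nn_integral_mono_AE) simp
    then show ?thesis
      by simp
  next
    case False
    then have "S > 0"
      using \<open>S \<ge> 0\<close> by simp
    then have S: "ennreal S * ennreal (1 / S) = 1"
      by (simp add: ennreal_mult[symmetric])
    have "(\<integral>\<^sup>+x. ennreal (1 / S) * ennreal (- f x) \<partial>M) \<le> (\<integral>\<^sup>+x. v x \<partial>M)"
    proof (rule nn_integral_mono_AE, use ae in eventually_elim)
      fix x assume "ennreal (- f x) \<le> ennreal S * v x"
      then have "ennreal (1 / S) * ennreal (- f x) \<le> ennreal (1 / S) * (ennreal S * v x)"
        by (rule mult_left_mono) simp
      also have "\<dots> = v x"
        using S by (metis mult.assoc mult.commute mult.left_neutral)
      finally show "ennreal (1 / S) * ennreal (- f x) \<le> v x" .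
    qed
    then have "ennreal S * (ennreal (1 / S) * (\<integral>\<^sup>+x. ennreal (- f x) \<partial>M)) \<le> ennreal S * (\<integral>\<^sup>+x. v x \<partial>M)"
      by (intro mult_left_mono) (simp_all add: nn_integral_cmult)
    then show ?thesis
      by (simp only: mult.assoc[symmetric] S mult_1_left)
  qed
  finally show ?thesis .
qed (simp add: not_integrable_integral_eq)

lemma sets_lebesgue_interval:
  fixes I :: "real set"
  assumes "is_interval I"
  shows "I \<in> sets lebesgue"
proof -
  have "\<exists>a b. I = {} \<or> I = UNIV \<or> I = {..<b} \<or> I = {..b} \<or> I = {a<..} \<or> I = {a..} \<or>
      I = {a<..<b} \<or> I = {a<..b} \<or> I = {a..<b} \<or> I = {a..b}"
    using assms[unfolded is_interval_1] by (intro interval_cases) blast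
  then have "I \<in> sets borel"
    by (elim exE disjE) simp_all
  then show ?thesis
    by simp
qed

theorem corollary18:
  fixes U \<Gamma> :: "('n::finite, 'm::finite) mink set"
    and I :: "real set"
    and \<mu> :: "real \<Rightarrow> ('n, 'm) mink measure"
    and \<phi> :: "('n, 'm) mink \<Rightarrow> real"
  assumes "open U" and "is_interval I"
    and "spacelike_brakke_flow U \<Gamma> I \<mu>"
    and "\<phi> \<in> Ck_compact 2 U" and "\<And>x. \<phi> x \<ge> 0"
    and "gradient_bound U \<Gamma> I \<mu> \<phi> < \<infinity>"
  shows "mono_on I (\<lambda>t. (\<integral>x. \<phi> x \<partial>\<mu> t)
           + real CARD('m) * (SUP x. hessian_norm \<phi> x) * enn2real (gradient_bound U \<Gamma> I \<mu> \<phi>) * t)"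
proof (rule mono_onI)
  fix a b assume I: "a \<in> I" "b \<in> I" and "a \<le> b"
  let ?K = "gradient_bound U \<Gamma> I \<mu> \<phi>" and ?\<psi> = "\<lambda>p::('n, 'm) mink \<times> real. \<phi> (fst p)"
  define S where "S = (SUP x. hessian_norm \<phi> x)"
  define k where "k = enn2real ?K"
  define g where "g t = (\<integral>x. brakke_integrand U (\<mu> t) ?\<psi> t x \<partial>\<mu> t)" for t
  have C2: "Ck_on 2 \<phi> UNIV" "compact (spt \<phi>)"
    using assms(4) by (auto simp: Ck_compact_def)
  have S: "hessian_norm \<phi> x \<le> S" for x
    unfolding S_def by (intro cSUP_upper bdd_above_hessian_norm C2) simp
  then have "S \<ge> 0"
    using order_trans[OF _ S] by (simp add: hessian_norm_def sum_nonneg)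
  have K: "?K = ennreal k" "k \<ge> 0"
    using assms(6) by (auto simp: k_def less_top)
  have ab: "{a..b} \<subseteq> I"
    using assms(2)[unfolded is_interval_1] I by (meson atLeastAtMost_iff subsetI)
  have "ennreal (\<integral>x. ?\<psi> (x, a) \<partial>\<mu> a) + (\<integral>\<^sup>+t. ennreal (g t) \<partial>lebesgue_on {a..b})
      \<le> ennreal (\<integral>x. ?\<psi> (x, b) \<partial>\<mu> b) + (\<integral>\<^sup>+t. ennreal (- g t) \<partial>lebesgue_on {a..b})"
    using assms(3)[unfolded spacelike_brakke_flow_def Let_def, THEN conjunct2, THEN conjunct2,
        THEN conjunct2, THEN conjunct2, rule_format, OF spacetime_test_fst[OF assms(4,5)]]
      \<open>a \<le> b\<close> ab by (simp add: g_def)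
  then have brakke: "ennreal (\<integral>x. \<phi> x \<partial>\<mu> a)
      \<le> ennreal (\<integral>x. \<phi> x \<partial>\<mu> b) + (\<integral>\<^sup>+t. ennreal (- g t) \<partial>lebesgue_on {a..b})"
    by (simp only: fst_conv) (rule order_trans[rotated], assumption, simp)
  have "AE t in lebesgue. t \<in> I \<longrightarrow> \<mu> t \<in> SV U \<Gamma>"
    using assms(3) sets_lebesgue_interval[OF assms(2)]
    by (simp add: spacelike_brakke_flow_def AE_restrict_space_iff)
  then have "AE t in lebesgue_on {a..b}. t \<in> I \<and> \<mu> t \<in> SV U \<Gamma>"
    using ab by (subst AE_restrict_space_iff) (auto elim!: eventually_mono)
  then have "AE t in lebesgue_on {a..b}. ennreal (- g t) \<le> ennreal (S * k)"
  proof eventually_elim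
    fix t assume t: "t \<in> I \<and> \<mu> t \<in> SV U \<Gamma>"
    have "ennreal (- g t) \<le> ennreal S * (\<integral>\<^sup>+x\<in>spt \<phi>. ennreal (gradient_function U \<Gamma> (\<mu> t) x) \<partial>\<mu> t)"
      unfolding g_def using t
      by (intro integral_ge_of_AE_ge \<open>S \<ge> 0\<close> brakke_integrand_AE_ge[OF assms(1)] C2 assms(5) S) auto
    also have "\<dots> \<le> ennreal S * ?K"
      unfolding gradient_bound_def using t by (intro mult_left_mono SUP_upper) auto
    finally show "ennreal (- g t) \<le> ennreal (S * k)"
      using K \<open>S \<ge> 0\<close> by (simp add: ennreal_mult)
  qed
  then have "(\<integral>\<^sup>+t. ennreal (- g t) \<partial>lebesgue_on {a..b}) \<le> (\<integral>\<^sup>+t. ennreal (S * k) \<partial>lebesgue_on {a..b})"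
    by (rule nn_integral_mono_AE)
  also have "\<dots> = ennreal (S * k * (b - a))"
    using \<open>a \<le> b\<close> \<open>S \<ge> 0\<close> K(2) by (simp add: emeasure_restrict_space ennreal_mult)
  finally have "ennreal (\<integral>x. \<phi> x \<partial>\<mu> a) \<le> ennreal (\<integral>x. \<phi> x \<partial>\<mu> b) + ennreal (S * k * (b - a))"
    by (rule order_trans[OF brakke add_left_mono])
  moreover have nonneg: "0 \<le> (\<integral>x. \<phi> x \<partial>\<mu> b)" "0 \<le> S * k * (b - a)"
    using \<open>a \<le> b\<close> \<open>S \<ge> 0\<close> K(2) by (simp_all add: assms(5))
  ultimately have "(\<integral>x. \<phi> x \<partial>\<mu> a) \<le> (\<integral>x. \<phi> x \<partial>\<mu> b) + S * k * (b - a)"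
    by (simp add: ennreal_plus[symmetric] del: ennreal_plus)
  moreover have "1 * (S * k * (b - a)) \<le> real CARD('m) * (S * k * (b - a))"
    by (rule mult_right_mono[OF _ nonneg(2)]) (simp add: Suc_leI)
  ultimately show "(\<integral>x. \<phi> x \<partial>\<mu> a) + real CARD('m) * (SUP x. hessian_norm \<phi> x) * enn2real ?K * a
      \<le> (\<integral>x. \<phi> x \<partial>\<mu> b) + real CARD('m) * (SUP x. hessian_norm \<phi> x) * enn2real ?K * b"
    unfolding S_def[symmetric] k_def[symmetric] by (simp add: algebra_simps)
qed

end
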